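(* Let $0\le\lambda<1$ and $\gamma>0$. Let $\Sigma_{SX}:\mathcal H_X\to\mathcal H_S$ be the operator induced by the bilinear functional $\mathrm{Cov}(\alpha(X),\beta(S))=\langle\Sigma_{SX}\alpha,\beta\rangle_{\mathcal H_S}$ ($\alpha\in\mathcal H_X$, $\beta\in\mathcal H_S$), and define $\Sigma_{YX}:\mathcal H_X\to\mathcal H_Y$ and $\Sigma_{XX}:\mathcal H_X\to\mathcal H_X$ similarly. Then a global optimizer of $$\sup_{\mathbf f\in\mathcal A_r}\big\{(1-\lambda)\,\mathrm{Dep}(\mathbf f(X),Y)-\lambda\,\mathrm{Dep}(\mathbf f(X),S)\big\}$$ is given by $\mathbf f=(f_1,\dots,f_r)$, where $f_1,\dots,f_r$ are eigenfunctions (normalized so that $\mathbf f\in\mathcal A_r$) corresponding to the $r$ largest eigenvalues $\tau$ of the generalized eigenvalue problem $$\big((1-\lambda)\Sigma_{YX}^*\Sigma_{YX}-\lambda\,\Sigma_{SX}^*\Sigma_{SX}\big)f=\tau\,(\Sigma_{XX}+\gamma I_X)f,\qquad f\in\mathcal H_X,$$ where $I_X$ is the identity operator on $\mathcal H_X$ and $\Sigma^*$ denotes the adjoint of $\Sigma$.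
   Context: $(X,Y,S)$ is a joint random variable with $X\in\mathbb R^{d_X}$, and $Y$, $S$ valued in $\mathbb R^{d_Y}$, $\mathbb R^{d_S}$ respectively (or in finite sets). $(\mathcal H_X,k_X)$ is a universal RKHS of real functions on $\mathbb R^{d_X}$; $(\mathcal H_Y,k_Y)$ and $(\mathcal H_S,k_S)$ are separable RKHSs of real functions on the ranges of $Y$ and $S$, with countable orthonormal bases $\mathcal U_Y$ and $\mathcal U_S$. The kernel functions are bounded, with $\mathbb E[k_U(U,U)]<\infty$ for $U=X,Y,S$. For $\mathbf f=(f_1,\dots,f_r)$ with $f_j\in\mathcal H_X$, $$\mathrm{Dep}(\mathbf f(X),S):=\sum_{j=1}^r\sum_{\beta\in\mathcal U_S}\mathrm{Cov}^2(f_j(X),\beta(S)),\qquad \mathrm{Dep}(\mathbf f(X),Y):=\sum_{j=1}^r\sum_{\beta\in\mathcal U_Y}\mathrm{Cov}^2(f_j(X),\beta(Y)).$$ The feasible set is $$\mathcal A_r:=\{(f_1,\dots,f_r)\,:\, f_i\in\mathcal H_X,\ \mathrm{Cov}(f_i(X),f_j(X))+\gamma\langle f_i,f_j\rangle_{\mathcal H_X}=\delta_{i,j}\ \text{for all }1\le i,j\le r\}.$$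
   Formalization: That r largest eigenvalues (counted with multiplicity) exist is assumed, since for λ>0 they may not (Y constant, S=X of full support, Gaussian kernels: supremum 0 is not attained); it is shown that they exist whenever a global optimizer exists. *)

theory Defs
  imports "HOL-Probability.Probability"
begin

text \<open>
  A Hilbert space of real functions on \<open>\<Omega>\<close> is a complete real inner product space \<open>'h\<close> (not
  necessarily separable) together with a map \<open>\<phi>\<close> sending each element to the function it stands
  for; elements are determined by their values on \<open>\<Omega>\<close>, and values outside \<open>\<Omega>\<close> are irrelevant.
  Linearity and boundedness of \<open>\<lambda>f. \<phi> f x\<close> follow from the reproducing property.
\<close>

definition rkhs ::
    "'a set \<Rightarrow> ('a \<Rightarrow> 'a \<Rightarrow> real) \<Rightarrow> ('h::{real_inner,complete_space} \<Rightarrow> 'a \<Rightarrow> real) \<Rightarrow> bool" where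
  "rkhs \<Omega> k \<phi> \<longleftrightarrow>
     (\<forall>f g. (\<forall>x\<in>\<Omega>. \<phi> f x = \<phi> g x) \<longrightarrow> f = g) \<and>
     (\<forall>x\<in>\<Omega>. \<exists>kx. (\<forall>y\<in>\<Omega>. \<phi> kx y = k x y) \<and> (\<forall>f. \<phi> f x = f \<bullet> kx))"

text \<open>Universality in the sense of Micchelli, Xu and Zhang: a continuous kernel whose functions are
  uniformly dense in the continuous functions on every compact set.\<close>

definition universal_rkhs ::
    "('a::topological_space \<Rightarrow> 'a \<Rightarrow> real) \<Rightarrow> ('h::{real_inner,complete_space} \<Rightarrow> 'a \<Rightarrow> real) \<Rightarrow> bool" where
  "universal_rkhs k \<phi> \<longleftrightarrow>
     rkhs UNIV k \<phi> \<and>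
     continuous_on UNIV (\<lambda>(x, y). k x y) \<and>
     (\<forall>Z g e. compact Z \<and> continuous_on Z (g :: 'a \<Rightarrow> real) \<and> e > 0 \<longrightarrow>
        (\<exists>f. \<forall>x\<in>Z. \<bar>\<phi> f x - g x\<bar> < e))"

text \<open>Measurability of the kernel makes all functions of the space measurable, so that the
  covariances below are meaningful.\<close>

definition admissible_kernel ::
    "'w measure \<Rightarrow> 'a measure \<Rightarrow> ('w \<Rightarrow> 'a) \<Rightarrow> ('a \<Rightarrow> 'a \<Rightarrow> real) \<Rightarrow> bool" where
  "admissible_kernel M N U k \<longleftrightarrow>
     (\<lambda>(x, y). k x y) \<in> borel_measurable (N \<Otimes>\<^sub>M N) \<and>
     bounded ((\<lambda>(x, y). k x y) ` (space N \<times> space N)) \<and>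
     integrable M (\<lambda>\<omega>. k (U \<omega>) (U \<omega>))"

definition orthonormal_basis :: "'h::real_inner set \<Rightarrow> bool" where
  "orthonormal_basis B \<longleftrightarrow>
     pairwise orthogonal B \<and> (\<forall>b\<in>B. norm b = 1) \<and> closure (span B) = UNIV"

definition covariance :: "'w measure \<Rightarrow> ('w \<Rightarrow> real) \<Rightarrow> ('w \<Rightarrow> real) \<Rightarrow> real" where
  "covariance M U V =
     (LINT \<omega>|M. (U \<omega> - (LINT \<omega>|M. U \<omega>)) * (V \<omega> - (LINT \<omega>|M. V \<omega>)))"

text \<open>The operator \<open>\<Sigma>\<close> induced by \<open>Cov(\<alpha>(U), \<beta>(V)) = \<langle>\<Sigma> \<alpha>, \<beta>\<rangle>\<close>, where \<open>\<alpha>\<close>, \<open>\<beta>\<close> range over the spaces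
  evaluated by \<open>evU\<close>, \<open>evV\<close>.\<close>

definition cov_operator ::
    "'w measure \<Rightarrow> ('h::real_inner \<Rightarrow> 'a \<Rightarrow> real) \<Rightarrow> ('w \<Rightarrow> 'a)
      \<Rightarrow> ('g::real_inner \<Rightarrow> 'b \<Rightarrow> real) \<Rightarrow> ('w \<Rightarrow> 'b) \<Rightarrow> 'h \<Rightarrow> 'g" where
  "cov_operator M evU U evV V =
     (THE T. \<forall>\<alpha> \<beta>. covariance M (\<lambda>\<omega>. evU \<alpha> (U \<omega>)) (\<lambda>\<omega>. evV \<beta> (V \<omega>)) = T \<alpha> \<bullet> \<beta>)"

text \<open>An \<open>r\<close>-tuple \<open>(f\<^sub>1, \<dots>, f\<^sub>r)\<close> is a function on \<open>nat\<close> of which only the values on \<open>{1..r}\<close> matter.\<close>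

definition dep ::
    "'w measure \<Rightarrow> ('h \<Rightarrow> 'a \<Rightarrow> real) \<Rightarrow> ('w \<Rightarrow> 'a)
      \<Rightarrow> ('g \<Rightarrow> 'b \<Rightarrow> real) \<Rightarrow> ('w \<Rightarrow> 'b) \<Rightarrow> 'g set \<Rightarrow> nat \<Rightarrow> (nat \<Rightarrow> 'h) \<Rightarrow> real" where
  "dep M evX X evV V B r f =
     (\<Sum>j=1..r. \<Sum>\<^sub>\<infinity>\<beta>\<in>B. (covariance M (\<lambda>\<omega>. evX (f j) (X \<omega>)) (\<lambda>\<omega>. evV \<beta> (V \<omega>)))\<^sup>2)"

definition feasible ::
    "'w measure \<Rightarrow> ('h::real_inner \<Rightarrow> 'a \<Rightarrow> real) \<Rightarrow> ('w \<Rightarrow> 'a) \<Rightarrow> real \<Rightarrow> nat \<Rightarrow> (nat \<Rightarrow> 'h) set" where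
  "feasible M evX X \<gamma> r =
     {f. \<forall>i\<in>{1..r}. \<forall>j\<in>{1..r}.
        covariance M (\<lambda>\<omega>. evX (f i) (X \<omega>)) (\<lambda>\<omega>. evX (f j) (X \<omega>)) + \<gamma> * (f i \<bullet> f j)
          = (if i = j then 1 else 0)}"

definition gen_eigenspace ::
    "('h::real_vector \<Rightarrow> 'h) \<Rightarrow> ('h \<Rightarrow> 'h) \<Rightarrow> real \<Rightarrow> 'h set" where
  "gen_eigenspace A B \<tau> = {f. A f = \<tau> *\<^sub>R B f}"

text \<open>The dimension of the eigenspace, which is \<open>0\<close> if \<open>\<tau>\<close> is not an eigenvalue. The case distinction
  is needed because \<open>dim\<close> is \<open>0\<close> for infinite-dimensional spaces.\<close>

definition gen_multiplicity ::
    "('h::real_vector \<Rightarrow> 'h) \<Rightarrow> ('h \<Rightarrow> 'h) \<Rightarrow> real \<Rightarrow> enat" where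
  "gen_multiplicity A B \<tau> =
     (if \<exists>Q. finite Q \<and> gen_eigenspace A B \<tau> \<subseteq> span Q
      then enat (dim (gen_eigenspace A B \<tau>)) else \<infinity>)"

text \<open>\<open>\<tau>\<^sub>1, \<dots>, \<tau>\<^sub>r\<close> (in any order) are the \<open>r\<close> largest eigenvalues counted with multiplicity: no value
  occurs more often than its multiplicity allows, and every value larger than some \<open>\<tau>\<^sub>i\<close> occurs
  exactly as often as its multiplicity. Such a list need not exist, since the eigenvalues may increase
  to a supremum that is not an eigenvalue.\<close>

definition largest_gen_eigenvalues ::
    "('h::real_vector \<Rightarrow> 'h) \<Rightarrow> ('h \<Rightarrow> 'h) \<Rightarrow> nat \<Rightarrow> (nat \<Rightarrow> real) \<Rightarrow> bool" where
  "largest_gen_eigenvalues A B r \<tau> \<longleftrightarrow>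
     (\<forall>\<sigma>. enat (card {i\<in>{1..r}. \<tau> i = \<sigma>}) \<le> gen_multiplicity A B \<sigma>) \<and>
     (\<forall>\<sigma>. (\<exists>i\<in>{1..r}. \<tau> i < \<sigma>) \<longrightarrow>
        enat (card {i\<in>{1..r}. \<tau> i = \<sigma>}) = gen_multiplicity A B \<sigma>)"

end

theory Submission
  imports Defs
begin

text \<open>
  Let \<open>b f g = Cov(f(X), g(X)) + \<gamma> \<langle>f, g\<rangle>\<close>, an inner product equivalent to that of the space, so that the
  feasible tuples are the \<open>b\<close>-orthonormal ones. By Lax--Milgram there is an operator \<open>T = B\<inverse> A\<close>, selfadjoint
  for \<open>b\<close>; the generalized eigenvectors are the eigenvectors of \<open>T\<close>, and by Parseval the objective is the
  trace \<open>\<Sum>\<^sub>i b (T f\<^sub>i) f\<^sub>i\<close>. The covariance operators are Hilbert--Schmidt because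
  \<open>\<Sum>\<^sub>\<beta> E \<beta>(Y)\<^sup>2 \<le> E k(Y, Y)\<close>, hence \<open>T\<close> is compact, and the claim is Ky Fan's trace principle. Conversely, a
  maximizing tuple spans an invariant subspace by first variation; diagonalizing \<open>T\<close> there and comparing
  with vectors orthogonal to the span shows that it carries the \<open>r\<close> largest eigenvalues.
\<close>

section \<open>Coercive symmetric bilinear forms\<close>

text \<open>Compactness is available in the norm of the space, selfadjointness only for
  \<open>b\<close>. Coercivity of \<open>b\<close> links the two, so \<open>T\<close> can be studied
  in the geometry of the constraint without square roots of \<open>B\<close>. The obstacle is that
  the quadratic form of \<open>A\<close> may be indefinite or negative. If all eigenvalues are
  negative in infinite dimension, they accumulate at 0 and there is no largest one, so eigenvectors
  cannot be produced from the top by maximizing the Rayleigh quotient. What survives is a local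
  statement: on a closed invariant subspace, a Rayleigh quotient above \<open>c\<close> forces an
  eigenvalue above \<open>c\<close>. With \<open>c\<close> the least of the listed eigenvalues, and
  the subspace the complement of the eigenfamily, this is all that Ky Fan's inequality
  requires.\<close>

lemma linear_coeff_zero:
  fixes \<alpha> \<beta> :: real
  assumes "\<And>t. 0 \<le> 2 * t * \<alpha> + t\<^sup>2 * \<beta>"
  shows "\<alpha> = 0"
proof (rule ccontr)
  assume "\<alpha> \<noteq> 0"
  \<comment> \<open>For positive \<beta> the minimizing \<open>t\<close> would be
    \<open>- \<alpha> / \<beta>\<close>, but \<beta> may be zero or negative; \<open>s\<close> is a
    positive upper bound that replaces it.\<close>
  define s where "s = 1 + \<bar>\<beta>\<bar>"
  have s: "s > 0" "\<beta> \<le> s" by (auto simp: s_def)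
  have "0 \<le> (2 * (- \<alpha> / s) * \<alpha> + (- \<alpha> / s)\<^sup>2 * \<beta>) * s\<^sup>2"
    using assms[of "- \<alpha> / s"] by simp
  also have "\<dots> = \<alpha>\<^sup>2 * (\<beta> - 2 * s)"
    using s by (simp add: field_simps power2_eq_square)
  also have "\<dots> < 0"
    using s \<open>\<alpha> \<noteq> 0\<close> by (intro mult_pos_neg) auto
  finally show False by simp
qed

text \<open>Used for two forms: \<open>inner\<close> with constant 1 and the regularized covariance
  form with constant \<gamma>. Projections, Bessel and Gram-Schmidt are thus developed once for both
  geometries.\<close>

locale coercive_form = bounded_bilinear b
  for b :: "'h::{real_inner,complete_space} \<Rightarrow> 'h \<Rightarrow> real" +
  fixes \<gamma> :: real
  assumes sym: "b f g = b g f"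
    and pos: "\<gamma> > 0"
    and coercive: "\<gamma> * (norm f)\<^sup>2 \<le> b f f"
begin

lemma self_nonneg: "0 \<le> b f f"
  using coercive[of f] pos by (smt (verit) mult_nonneg_nonneg zero_le_power2)

lemma self_eq_0_iff [simp]: "b f f = 0 \<longleftrightarrow> f = 0"
proof
  assume "b f f = 0"
  then have "\<gamma> * (norm f)\<^sup>2 \<le> 0" using coercive[of f] by simp
  then show "f = 0" using pos by (simp add: mult_le_0_iff)
qed (simp add: zero_left)

lemma self_pos: "f \<noteq> 0 \<Longrightarrow> 0 < b f f"
  using self_nonneg[of f] self_eq_0_iff[of f] by linarith

lemma self_tendsto_0:
  assumes "(\<lambda>n. b (f n) (f n)) \<longlonglongrightarrow> 0"
  shows "f \<longlonglongrightarrow> 0"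
proof -
  have "(\<lambda>n. b (f n) (f n) / \<gamma>) \<longlonglongrightarrow> 0"
    using tendsto_divide[OF assms tendsto_const[of \<gamma>]] pos by simp
  then have "(\<lambda>n. (norm (f n))\<^sup>2) \<longlonglongrightarrow> 0"
    by (rule tendsto_sandwich[OF _ _ tendsto_const, rotated 2])
      (use coercive pos in \<open>auto simp: field_simps intro!: always_eventually\<close>)
  then have "(\<lambda>n. norm (f n)) \<longlonglongrightarrow> 0"
    using tendsto_real_sqrt by fastforce
  then show ?thesis by (rule tendsto_norm_zero_cancel)
qed

text \<open>\<open>u\<close> is the minimizer of \<open>\<lambda>f. b f f - 2 * l f\<close> on \<open>W\<close>; minimizing sequences are Cauchy by the
  parallelogram law.\<close>

theorem lax_milgram:
  assumes W: "subspace W" "closed W" and l: "bounded_linear l"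
  shows "\<exists>u\<in>W. \<forall>h\<in>W. b u h = l h"
proof -
  interpret l: bounded_linear l by (rule l)
  define \<phi> where "\<phi> f = b f f - 2 * l f" for f
  obtain L where L: "\<And>f. norm (l f) \<le> norm f * L" using l.bounded by blast
  \<comment> \<open>Completing the square: the coercive quadratic term dominates
    \<open>2 * l f\<close> up to a constant.\<close>
  have lower: "- L\<^sup>2 / \<gamma> \<le> \<phi> f" for f
  proof -
    have "0 \<le> (\<gamma> * norm f - L)\<^sup>2 / \<gamma>" using pos by simp
    also have "\<dots> = \<gamma> * (norm f)\<^sup>2 - 2 * (norm f * L) + L\<^sup>2 / \<gamma>"
      using pos by (simp add: field_simps power2_eq_square)
    also have "\<dots> \<le> \<phi> f + L\<^sup>2 / \<gamma>"
      using coercive[of f] L[of f] unfolding \<phi>_def by (simp add: abs_le_iff)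
    finally show ?thesis by simp
  qed
  define m where "m = Inf (\<phi> ` W)"
  have bdd: "bdd_below (\<phi> ` W)" by (rule bdd_belowI2[OF lower])
  have ne: "\<phi> ` W \<noteq> {}" using subspace_0[OF W(1)] by blast
  have m: "m \<le> \<phi> f" if "f \<in> W" for f unfolding m_def using bdd that by (simp add: cInf_lower)
  have "\<exists>f\<in>W. \<phi> f < m + inverse (real (Suc n))" for n
    using cInf_lessD[OF ne, of "m + inverse (real (Suc n))"] unfolding m_def by auto
  then obtain x where x: "\<And>n. x n \<in> W" "\<And>n. \<phi> (x n) < m + inverse (real (Suc n))"
    by metis
  \<comment> \<open>The linear part of \<open>\<phi>\<close> drops out at the midpoint, so only the
    parallelogram defect of the quadratic part remains.\<close>
  have par: "\<phi> f + \<phi> g - 2 * \<phi> ((1/2) *\<^sub>R (f + g)) = b (f - g) (f - g) / 2" for f g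
    unfolding \<phi>_def
    by (simp add: add_left add_right diff_left diff_right scaleR_left scaleR_right
        l.add l.scaleR sym[of g f] field_simps)
  have close: "\<gamma> * (norm (x n - x k))\<^sup>2 \<le> 2 * (inverse (real (Suc n)) + inverse (real (Suc k)))" for n k
  proof -
    have "(1/2) *\<^sub>R (x n + x k) \<in> W"
      using W x by (simp add: subspace_add subspace_mul)
    from m[OF this] have "b (x n - x k) (x n - x k) / 2 \<le> \<phi> (x n) + \<phi> (x k) - 2 * m"
      unfolding par[symmetric] by simp
    also have "\<dots> \<le> inverse (real (Suc n)) + inverse (real (Suc k))"
      using less_imp_le[OF add_strict_mono[OF x(2)[of n] x(2)[of k]]] by (simp add: algebra_simps)
    finally show ?thesis using coercive[of "x n - x k"] by simp
  qed
  have "Cauchy x"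
  proof (rule metric_CauchyI)
    fix e :: real assume "e > 0"
    then have "\<gamma> * e\<^sup>2 / 4 > 0" using pos by simp
    then obtain N where N: "inverse (real (Suc N)) < \<gamma> * e\<^sup>2 / 4"
      using reals_Archimedean by blast
    have "dist (x i) (x k) < e" if "i \<ge> N" "k \<ge> N" for i k
    proof -
      define d where "d n = inverse (real (Suc n))" for n
      have "d i \<le> d N" "d k \<le> d N"
        unfolding d_def using that by (auto intro!: le_imp_inverse_le)
      moreover have "d N < \<gamma> * e\<^sup>2 / 4" using N by (simp add: d_def)
      ultimately have "2 * (d i + d k) < \<gamma> * e\<^sup>2" by simp
      then have "\<gamma> * (norm (x i - x k))\<^sup>2 < \<gamma> * e\<^sup>2"
        using close[of i k] unfolding d_def by (rule le_less_trans[rotated])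
      then have "(norm (x i - x k))\<^sup>2 < e\<^sup>2" using pos by simp
      then show ?thesis using \<open>e > 0\<close> by (simp add: dist_norm power_less_imp_less_base)
    qed
    then show "\<exists>N. \<forall>i\<ge>N. \<forall>k\<ge>N. dist (x i) (x k) < e" by blast
  qed
  then obtain u where u: "x \<longlonglongrightarrow> u" using Cauchy_convergent convergent_def by blast
  have "u \<in> W" using W(2) x(1) u by (rule closed_sequentially)
  have "(\<lambda>n. \<phi> (x n)) \<longlonglongrightarrow> \<phi> u"
    unfolding \<phi>_def by (intro tendsto_intros tendsto u l.tendsto)
  moreover have "(\<lambda>n. m + inverse (real (Suc n))) \<longlonglongrightarrow> m + 0"
    by (intro tendsto_intros LIMSEQ_inverse_real_of_nat)
  ultimately have "\<phi> u \<le> m"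
    using x(2) by (intro LIMSEQ_le[of _ "\<phi> u" _ m]) (auto intro: less_imp_le)
  have "b u h = l h" if "h \<in> W" for h
  proof -
    \<comment> \<open>Minimality of \<open>u\<close> along the line
      \<open>u + t *\<^sub>R h\<close>; the linear coefficient has to vanish.\<close>
    have "0 \<le> 2 * t * (b u h - l h) + t\<^sup>2 * b h h" for t
    proof -
      have "u + t *\<^sub>R h \<in> W" using W \<open>u \<in> W\<close> that by (simp add: subspace_add subspace_mul)
      then have "\<phi> u \<le> \<phi> (u + t *\<^sub>R h)" using m \<open>\<phi> u \<le> m\<close> by fastforce
      then show ?thesis
        unfolding \<phi>_def
        by (simp add: add_left add_right scaleR_left scaleR_right l.add l.scaleR sym[of h u]
            algebra_simps power2_eq_square)
    qed
    from linear_coeff_zero[OF this] show ?thesis by simp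
  qed
  with \<open>u \<in> W\<close> show ?thesis by blast
qed

text \<open>The \<open>b\<close>-orthogonal projection of \<open>f\<close> represents the functional
  \<open>b f\<close> on \<open>W\<close>, so it comes from the same minimization.\<close>

corollary projection_exists:
  assumes "subspace W" "closed W"
  shows "\<exists>u\<in>W. \<forall>h\<in>W. b (f - u) h = 0"
  using lax_milgram[OF assms bounded_linear_right[of f]] by (simp add: diff_left) metis

text \<open>Nondegeneracy of \<open>b\<close> forces linearity, and testing the identity with
  \<open>g = T f\<close> bounds the norm. Keeping existence apart lets this apply to operators given
  in advance by description or choice, such as covariance operators and their adjoints.\<close>

lemma bounded_linear_of_bilinear_form:
  assumes c: "bounded_bilinear c" and T: "\<And>f g. b (T f) g = c f g"
  shows "bounded_linear T"
proof -
  interpret c: bounded_bilinear c by (rule c)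
  have ext: "u = v" if "\<And>g. b u g = b v g" for u v
    using that[of "u - v"] self_eq_0_iff[of "u - v"] by (simp add: diff_left)
  obtain K where K: "\<And>f g. norm (c f g) \<le> norm f * norm g * K" "K > 0" using c.pos_bounded by blast
  show ?thesis
  proof (rule bounded_linear_intro[where K="K / \<gamma>"])
    show "T (x + y) = T x + T y" for x y
      by (rule ext) (simp add: add_left T c.add_left)
    show "T (r *\<^sub>R x) = r *\<^sub>R T x" for r x
      by (rule ext) (simp add: scaleR_left T c.scaleR_left)
    show "norm (T x) \<le> norm x * (K / \<gamma>)" for x
    proof (cases "T x = 0")
      case True
      then show ?thesis using K(2) pos by simp
    next
      case False
      have "norm (T x) * (\<gamma> * norm (T x)) \<le> c x (T x)"
        using coercive[of "T x"] T[of x "T x"] by (simp add: power2_eq_square mult.left_commute)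
      also have "\<dots> \<le> norm (c x (T x))" by simp
      also have "\<dots> \<le> norm x * norm (T x) * K" by (rule K(1))
      also have "\<dots> = norm (T x) * (norm x * K)" by simp
      finally have "\<gamma> * norm (T x) \<le> norm x * K" using False by simp
      then show ?thesis using pos by (simp add: field_simps)
    qed
  qed
qed

lemma operator_of_bilinear_form:
  assumes c: "bounded_bilinear c"
  shows "\<exists>T. bounded_linear T \<and> (\<forall>f g. b (T f) g = c f g)"
proof -
  have "\<exists>u. \<forall>g. b u g = c f g" for f
    using lax_milgram[OF subspace_UNIV closed_UNIV bounded_bilinear.bounded_linear_right[OF c, of f]] by blast
  then obtain T where T: "\<And>f g. b (T f) g = c f g" by metis
  with bounded_linear_of_bilinear_form[OF c T] show ?thesis by blast
qed

end

interpretation inner: coercive_form "inner :: 'h::{real_inner,complete_space} \<Rightarrow> 'h \<Rightarrow> real" 1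
  by (intro coercive_form.intro bounded_bilinear_inner coercive_form_axioms.intro)
    (auto simp: inner_commute power2_norm_eq_inner)

section \<open>Compact selfadjoint operators\<close>

lemma subspace_closure_span: "subspace (closure (span (E :: 'a::real_normed_vector set)))"
proof (rule subspaceI)
  show "0 \<in> closure (span E)" by (meson closure_subset span_zero subsetD)
  show "x + y \<in> closure (span E)" if xy: "x \<in> closure (span E)" "y \<in> closure (span E)" for x y
  proof -
    obtain f g where "\<And>n. f n \<in> span E" "f \<longlonglongrightarrow> x" "\<And>n. g n \<in> span E" "g \<longlonglongrightarrow> y"
      using xy unfolding closure_sequential by blast
    then show ?thesis unfolding closure_sequential
      by (intro exI[of _ "\<lambda>n. f n + g n"]) (auto intro: span_add tendsto_add)
  qed
  show "c *\<^sub>R x \<in> closure (span E)" if x: "x \<in> closure (span E)" for c x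
  proof -
    obtain f where "\<And>n. f n \<in> span E" "f \<longlonglongrightarrow> x"
      using x unfolding closure_sequential by blast
    then show ?thesis unfolding closure_sequential
      by (intro exI[of _ "\<lambda>n. c *\<^sub>R f n"]) (auto intro: span_mul tendsto_scaleR)
  qed
qed

text \<open>Selfadjointness refers to \<open>b\<close>, compactness to the unit ball of the original
  norm. \<open>K\<close> is any compact superset of the image, since in the application it is a
  continuous image of a compact product rather than a closure.\<close>

locale compact_selfadjoint = coercive_form b \<gamma> + T: bounded_linear T
  for b :: "'h::{real_inner,complete_space} \<Rightarrow> 'h \<Rightarrow> real" and \<gamma> and T :: "'h \<Rightarrow> 'h" +
  fixes K :: "'h set"
  assumes selfadj: "b (T f) g = b f (T g)"
    and compact: "compact K" "T ` cball 0 1 \<subseteq> K"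
begin

text \<open>An approximate maximizer of the Rayleigh quotient is an approximate eigenvector.\<close>

lemma residual_bound:
  assumes C: "\<And>f. \<mu> * b f f - b (T f) f \<le> C * b f f" "C > 0"
    and max: "\<And>f. f \<in> W \<Longrightarrow> b (T f) f \<le> \<mu> * b f f"
    and W: "subspace W" "T ` W \<subseteq> W" "x \<in> W"
  defines "res \<equiv> \<mu> *\<^sub>R x - T x"
  shows "b res res \<le> C * (\<mu> * b x x - b (T x) x)"
proof -
  define p where "p f = \<mu> * b f f - b (T f) f" for f
  have "res \<in> W" using W unfolding res_def by (auto intro!: subspace_diff subspace_mul)
  \<comment> \<open>Among steps along \<open>res\<close>, the length \<open>- 1 / C\<close>
    minimizes the upper bound
    \<open>p x + 2 * t * b res res + t\<^sup>2 * (C * b res res)\<close>.\<close>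
  then have "x + (- 1 / C) *\<^sub>R res \<in> W" using W by (intro subspace_add subspace_mul)
  then have "0 \<le> p (x + (- 1 / C) *\<^sub>R res)" using max unfolding p_def by simp
  also have "\<dots> = p x + 2 * (- 1 / C) * b res res + (- 1 / C)\<^sup>2 * p res"
  proof -
    have "p (x + s *\<^sub>R h) = p x + 2 * s * b (\<mu> *\<^sub>R x - T x) h + s\<^sup>2 * p h" for s h
      unfolding p_def
      by (simp add: add_left add_right diff_left diff_right scaleR_left scaleR_right T.add T.scaleR
          sym[of h x] selfadj[of h x] sym[of h "T x"] algebra_simps power2_eq_square)
    then show ?thesis unfolding res_def by blast
  qed
  also have "\<dots> \<le> p x + 2 * (- 1 / C) * b res res + (- 1 / C)\<^sup>2 * (C * b res res)"
    using C(1)[of res] unfolding p_def by (intro add_left_mono mult_left_mono) auto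
  also have "\<dots> = p x - b res res / C"
    using C(2) by (simp add: field_simps power2_eq_square)
  finally show ?thesis using C(2) by (simp add: p_def field_simps)
qed

text \<open>A normalized maximizing sequence for the Rayleigh quotient has residuals tending to 0,
  and compactness makes \<open>T (x n)\<close> converge along a subsequence. Positivity of the
  supremum \<mu> carries convergence over to \<open>x n\<close>, which is the residual plus
  \<open>T (x n)\<close>, divided by \<mu>.\<close>

lemma eigenvector_exists_pos:
  assumes W: "subspace W" "closed W" "T ` W \<subseteq> W"
    and f0: "f0 \<in> W" "b (T f0) f0 > 0"
  shows "\<exists>e\<in>W. e \<noteq> 0 \<and> (\<exists>\<tau>. T e = \<tau> *\<^sub>R e)"
proof -
  define R where "R = (\<lambda>f. b (T f) f) ` {f\<in>W. b f f = 1}"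
  obtain Kb where Kb: "\<And>f g. norm (b f g) \<le> norm f * norm g * Kb" "Kb > 0" using pos_bounded by blast
  obtain Kt where Kt: "\<And>f. norm (T f) \<le> norm f * Kt" "Kt > 0" using T.pos_bounded by blast
  define C0 where "C0 = Kt * Kb / \<gamma>"
  have "C0 > 0" using Kb Kt pos by (simp add: C0_def)
  have q_bound: "\<bar>b (T f) f\<bar> \<le> C0 * b f f" for f
  proof -
    have "\<bar>b (T f) f\<bar> \<le> norm (T f) * norm f * Kb" using Kb(1)[of "T f" f] by simp
    also have "\<dots> \<le> norm f * Kt * norm f * Kb"
      using Kt(1)[of f] Kb(2) by (intro mult_right_mono) auto
    also have "\<dots> = Kt * Kb / \<gamma> * (\<gamma> * (norm f)\<^sup>2)"
      using pos by (simp add: power2_eq_square)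
    also have "\<dots> \<le> C0 * b f f"
      unfolding C0_def using Kb Kt pos coercive[of f] by (intro mult_left_mono) auto
    finally show ?thesis .
  qed
  have bdd: "bdd_above R"
    unfolding R_def
  proof (intro bdd_aboveI2)
    show "b (T f) f \<le> C0" if "f \<in> {f \<in> W. b f f = 1}" for f
      using q_bound[of f] that by simp
  qed
  have normalize: "b (T f) f / b f f \<in> R" if "f \<in> W" "f \<noteq> 0" for f
  proof -
    have "b f f > 0" using that(2) by (rule self_pos)
    then have "b ((1 / sqrt (b f f)) *\<^sub>R f) ((1 / sqrt (b f f)) *\<^sub>R f) = 1"
      "b (T ((1 / sqrt (b f f)) *\<^sub>R f)) ((1 / sqrt (b f f)) *\<^sub>R f) = b (T f) f / b f f"
      using that(2) by (simp_all add: scaleR_left scaleR_right T.scaleR)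
    with that W(1) show ?thesis unfolding R_def
      by (intro image_eqI[where x="(1 / sqrt (b f f)) *\<^sub>R f"]) (auto intro: subspace_mul)
  qed
  define \<mu> where "\<mu> = Sup R"
  have "f0 \<noteq> 0" using f0 by (auto simp: zero_right)
  with f0 have ne: "R \<noteq> {}" using normalize by blast
  have max: "b (T f) f \<le> \<mu> * b f f" if "f \<in> W" for f
  proof (cases "f = 0")
    case False
    then have "b (T f) f / b f f \<le> \<mu>"
      unfolding \<mu>_def using bdd that normalize by (simp add: cSup_upper)
    then show ?thesis using self_pos[OF False] by (simp add: field_simps)
  qed (simp add: zero_right)
  have "\<mu> > 0"
    using max[OF f0(1)] f0(2) self_nonneg[of f0] by (smt (verit) mult_nonpos_nonneg)
  have "\<exists>f\<in>W. b f f = 1 \<and> \<mu> - inverse (real (Suc n)) < b (T f) f" for n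
  proof -
    have "\<mu> - inverse (real (Suc n)) < Sup R" unfolding \<mu>_def by simp
    from less_cSupD[OF ne this] show ?thesis unfolding R_def by auto
  qed
  then obtain x where x: "\<And>n. x n \<in> W" "\<And>n. b (x n) (x n) = 1"
    "\<And>n. \<mu> - inverse (real (Suc n)) < b (T (x n)) (x n)" by metis
  define C where "C = \<mu> + C0"
  have "C > 0" using \<open>\<mu> > 0\<close> \<open>C0 > 0\<close> by (simp add: C_def)
  have "\<mu> * b f f - b (T f) f \<le> C * b f f" for f
    using q_bound[of f] by (simp add: C_def algebra_simps abs_le_iff)
  note rb = residual_bound[OF this \<open>C > 0\<close> max W(1) W(3)]
  define res where "res n = \<mu> *\<^sub>R x n - T (x n)" for n
  have "(\<lambda>n. b (res n) (res n)) \<longlonglongrightarrow> 0"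
  proof (rule tendsto_sandwich[OF _ _ tendsto_const])
    show "\<forall>\<^sub>F n in sequentially. b (res n) (res n) \<le> C * inverse (real (Suc n))"
    proof (intro always_eventually allI)
      fix n
      have "b (res n) (res n) \<le> C * (\<mu> - b (T (x n)) (x n))"
        using rb[OF _ x(1)[of n]] x(2)[of n] unfolding res_def by simp
      also have "\<dots> \<le> C * inverse (real (Suc n))"
        using x(3)[of n] \<open>C > 0\<close> by (intro mult_left_mono) auto
      finally show "b (res n) (res n) \<le> C * inverse (real (Suc n))" .
    qed
    show "(\<lambda>n. C * inverse (real (Suc n))) \<longlonglongrightarrow> 0"
      using tendsto_mult_left[OF LIMSEQ_inverse_real_of_nat, of C] by simp
  qed (auto simp: self_nonneg)
  then have res0: "res \<longlonglongrightarrow> 0" by (rule self_tendsto_0)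
  \<comment> \<open>Since \<open>b (x n) (x n) = 1\<close>, coercivity puts
    \<open>s *\<^sub>R x n\<close> into the unit ball, where compactness of \<open>T\<close>
    applies.\<close>
  define s where "s = sqrt \<gamma>"
  have "s > 0" using pos by (simp add: s_def)
  have "s *\<^sub>R T (x n) \<in> K" for n
  proof -
    have "(norm (s *\<^sub>R x n))\<^sup>2 \<le> 1"
      using coercive[of "x n"] x(2)[of n] pos by (simp add: s_def power_mult_distrib)
    then have "norm (s *\<^sub>R x n) \<le> 1" by (simp add: abs_square_le_1)
    then have "T (s *\<^sub>R x n) \<in> K" using compact(2) by (auto simp: subset_eq)
    then show ?thesis by (simp add: T.scaleR)
  qed
  then obtain l \<rho> where \<rho>: "strict_mono (\<rho> :: nat \<Rightarrow> nat)" "((\<lambda>n. s *\<^sub>R T (x n)) \<circ> \<rho>) \<longlonglongrightarrow> l"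
    using compact(1) unfolding compact_def by meson
  have "(\<lambda>n. (1/s) *\<^sub>R (((\<lambda>n. s *\<^sub>R T (x n)) \<circ> \<rho>) n)) \<longlonglongrightarrow> (1/s) *\<^sub>R l"
    by (intro tendsto_intros \<rho>)
  then have Tl: "(\<lambda>n. T (x (\<rho> n))) \<longlonglongrightarrow> (1/s) *\<^sub>R l" using \<open>s > 0\<close> by simp
  have "(\<lambda>n. (1/\<mu>) *\<^sub>R (res (\<rho> n) + T (x (\<rho> n)))) \<longlonglongrightarrow> (1/\<mu>) *\<^sub>R (0 + (1/s) *\<^sub>R l)"
    using LIMSEQ_subseq_LIMSEQ[OF res0 \<rho>(1)] by (intro tendsto_intros Tl) (simp add: o_def)
  then have xl: "(\<lambda>n. x (\<rho> n)) \<longlonglongrightarrow> (1/\<mu>) *\<^sub>R (1/s) *\<^sub>R l" (is "_ \<longlonglongrightarrow> ?e")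
    using \<open>\<mu> > 0\<close> by (simp add: res_def)
  have "?e \<in> W" using closed_sequentially[OF W(2) _ xl] x(1) by blast
  moreover have "b ?e ?e = 1"
    using LIMSEQ_unique[OF tendsto[OF xl xl]] x(2) by simp
  then have "?e \<noteq> 0" by (metis zero_left zero_neq_one)
  moreover have "T ?e = \<mu> *\<^sub>R ?e"
    using LIMSEQ_unique[OF T.tendsto[OF xl] Tl] \<open>\<mu> > 0\<close> by simp
  ultimately show ?thesis by blast
qed

lemma compact_selfadjoint_uminus: "compact_selfadjoint b \<gamma> (\<lambda>f. - T f) (uminus ` K)"
proof (intro compact_selfadjoint.intro compact_selfadjoint_axioms.intro)
  show "bounded_linear (\<lambda>f. - T f)" by (rule bounded_linear_minus[OF T.bounded_linear_axioms])
  show "compact (uminus ` K)" using compact(1) by (rule compact_negations)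
  show "(\<lambda>f. - T f) ` cball 0 1 \<subseteq> uminus ` K" using compact(2) by blast
qed (auto simp: coercive_form_axioms minus_left minus_right selfadj)

text \<open>A nonzero value of the quadratic form can be made positive by passing to
  \<open>- T\<close>. If the form vanishes on all of \<open>W\<close>, its value at
  \<open>f0 + T f0\<close> reduces to \<open>2 * b (T f0) (T f0)\<close>, so \<open>f0\<close> is
  itself an eigenvector for 0.\<close>

lemma eigenvector_exists:
  assumes W: "subspace W" "closed W" "T ` W \<subseteq> W" and f0: "f0 \<in> W" "f0 \<noteq> 0"
  shows "\<exists>e\<in>W. e \<noteq> 0 \<and> (\<exists>\<tau>. T e = \<tau> *\<^sub>R e)"
proof (cases "\<forall>f\<in>W. b (T f) f = 0")
  case True
  have "T f0 \<in> W" using W f0 by blast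
  then have "f0 + T f0 \<in> W" using W f0 by (simp add: subspace_add)
  then have "b (T (f0 + T f0)) (f0 + T f0) = 0" using True by blast
  then have "b (T f0) (T f0) = 0"
    using True[rule_format, OF f0(1)] True[rule_format, OF \<open>T f0 \<in> W\<close>]
    by (simp add: T.add add_left add_right selfadj[of "T f0" f0])
  then have "T f0 = 0 *\<^sub>R f0" by simp
  with f0 show ?thesis by blast
next
  case False
  then obtain f where f: "f \<in> W" "b (T f) f \<noteq> 0" by blast
  show ?thesis
  proof (cases "b (T f) f > 0")
    case True
    with f W show ?thesis by (intro eigenvector_exists_pos)
  next
    case neg: False
    interpret neg: compact_selfadjoint b \<gamma> "\<lambda>f. - T f" "uminus ` K"
      by (rule compact_selfadjoint_uminus)
    have "\<exists>e\<in>W. e \<noteq> 0 \<and> (\<exists>\<tau>. - T e = \<tau> *\<^sub>R e)"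
      using f neg W by (intro neg.eigenvector_exists_pos) (auto simp: minus_left intro: subspace_neg)
    then obtain e \<tau> where "e \<in> W" "e \<noteq> 0" "- T e = \<tau> *\<^sub>R e" by blast
    then have "T e = (- \<tau>) *\<^sub>R e" by (metis add.inverse_inverse scaleR_minus_left)
    with \<open>e \<in> W\<close> \<open>e \<noteq> 0\<close> show ?thesis by blast
  qed
qed

lemma eigenvectors_orthogonal:
  assumes "T f = \<sigma> *\<^sub>R f" "T g = \<tau> *\<^sub>R g" "\<sigma> \<noteq> \<tau>"
  shows "b f g = 0"
  using selfadj[of f g] assms by (simp add: scaleR_left scaleR_right)

text \<open>Collecting terms by eigenvalue writes \<open>f\<close> as a finite sum of mutually
  \<open>b\<close>-orthogonal eigenvectors with distinct eigenvalues, which makes both quadratic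
  forms diagonal.\<close>

lemma rayleigh_le_on_span_eigenvectors:
  assumes "f \<in> span {e. \<exists>\<sigma>\<le>c. T e = \<sigma> *\<^sub>R e}"
  shows "b (T f) f \<le> c * b f f"
proof -
  define P where "P f \<longleftrightarrow> (\<exists>F g. finite F \<and> F \<subseteq> {..c} \<and> (\<forall>\<sigma>. T (g \<sigma>) = \<sigma> *\<^sub>R g \<sigma>)
     \<and> f = (\<Sum>\<sigma>\<in>F. g \<sigma>))" for f
  have "P f"
    using assms
  proof (induction rule: span_induct_alt)
    case base
    show ?case unfolding P_def by (intro exI[of _ "{}"] exI[of _ "\<lambda>_. 0"]) (simp add: T.zero)
  next
    case (step a x y)
    obtain \<sigma> where \<sigma>: "\<sigma> \<le> c" "T x = \<sigma> *\<^sub>R x" using step by blast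
    obtain F g where F: "finite F" "F \<subseteq> {..c}" "\<forall>\<sigma>. T (g \<sigma>) = \<sigma> *\<^sub>R g \<sigma>" "y = (\<Sum>\<sigma>\<in>F. g \<sigma>)"
      using step unfolding P_def by blast
    \<comment> \<open>The old family is cut off outside \<open>F\<close>, where its eigenvectors are
      arbitrary, before the new vector joins the component for \<sigma>; this covers \<sigma> inside
      and outside \<open>F\<close> at once.\<close>
    define g' where "g' \<rho> = (if \<rho> \<in> F then g \<rho> else 0) + (if \<rho> = \<sigma> then a *\<^sub>R x else 0)" for \<rho>
    have "(\<Sum>\<rho>\<in>insert \<sigma> F. g' \<rho>) = (\<Sum>\<rho>\<in>insert \<sigma> F. if \<rho> \<in> F then g \<rho> else 0) + a *\<^sub>R x"
      unfolding g'_def using F(1) by (simp only: sum.distrib sum.delta finite_insert insertI1 if_True)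
    also have "(\<Sum>\<rho>\<in>insert \<sigma> F. if \<rho> \<in> F then g \<rho> else 0) = y"
      unfolding F(4) using F(1) by (intro sum.mono_neutral_cong_right) auto
    finally have "a *\<^sub>R x + y = (\<Sum>\<rho>\<in>insert \<sigma> F. g' \<rho>)" by simp
    moreover have "T (g' \<rho>) = \<rho> *\<^sub>R g' \<rho>" for \<rho>
      using F(3) \<sigma>(2) unfolding g'_def by (simp add: T.add T.scaleR T.zero scaleR_add_right)
    ultimately show ?case
      using F \<sigma> unfolding P_def by (intro exI[of _ "insert \<sigma> F"] exI[of _ g']) auto
  qed
  then obtain F g where F: "finite F" "F \<subseteq> {..c}" "\<And>\<sigma>. T (g \<sigma>) = \<sigma> *\<^sub>R g \<sigma>" "f = (\<Sum>\<sigma>\<in>F. g \<sigma>)"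
    unfolding P_def by blast
  have orth: "b (g \<sigma>) (g \<rho>) = 0" if "\<sigma> \<noteq> \<rho>" for \<sigma> \<rho>
    using eigenvectors_orthogonal[OF F(3) F(3) that] .
  have *: "(\<Sum>\<rho>\<in>F. b (g \<sigma>) (g \<rho>)) = b (g \<sigma>) (g \<sigma>)" if "\<sigma> \<in> F" for \<sigma>
    using that F(1) by (subst sum.remove[of _ \<sigma>]) (auto intro!: sum.neutral orth)
  have "b (T f) f = (\<Sum>\<sigma>\<in>F. \<sigma> * (\<Sum>\<rho>\<in>F. b (g \<sigma>) (g \<rho>)))"
    unfolding F(4)
    by (simp add: T.sum F(3) sum_left sum_right scaleR_left sum_distrib_left) (rule sum.swap)
  also have "\<dots> = (\<Sum>\<sigma>\<in>F. \<sigma> * b (g \<sigma>) (g \<sigma>))" using * by simp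
  also have "\<dots> \<le> (\<Sum>\<sigma>\<in>F. c * b (g \<sigma>) (g \<sigma>))"
    using F(2) by (intro sum_mono mult_right_mono self_nonneg) auto
  also have "\<dots> = c * (\<Sum>\<sigma>\<in>F. \<Sum>\<rho>\<in>F. b (g \<sigma>) (g \<rho>))" using * by (simp add: sum_distrib_left)
  also have "(\<Sum>\<sigma>\<in>F. \<Sum>\<rho>\<in>F. b (g \<sigma>) (g \<rho>)) = b f f"
    unfolding F(4) by (simp add: sum_left sum_right) (rule sum.swap)
  finally show ?thesis .
qed

text \<open>Splitting off the closed span of the eigenvectors with eigenvalue at most \<open>c\<close> leaves a nonzero
  invariant subspace. This avoids any discussion of whether the supremum of the Rayleigh quotient
  is attained, which can fail when all eigenvalues are negative.\<close>

lemma large_eigenvalue_exists: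
  assumes W: "subspace W" "closed W" "T ` W \<subseteq> W"
    and f: "f \<in> W" "b (T f) f > c * b f f"
  shows "\<exists>e\<in>W. e \<noteq> 0 \<and> (\<exists>\<tau>>c. T e = \<tau> *\<^sub>R e)"
proof -
  define E where "E = {e\<in>W. \<exists>\<sigma>\<le>c. T e = \<sigma> *\<^sub>R e}"
  define V where "V = closure (span E)"
  have V: "subspace V" "closed V" unfolding V_def by (auto simp: subspace_closure_span)
  have "V \<subseteq> W"
    unfolding V_def using W by (intro closure_minimal span_minimal) (auto simp: E_def)
  have "E \<subseteq> V" unfolding V_def by (meson closure_subset order_trans span_superset)
  have rV: "b (T v) v \<le> c * b v v" if v: "v \<in> V" for v
  proof -
    obtain x where x: "\<And>n. x n \<in> span E" "x \<longlonglongrightarrow> v"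
      using v unfolding V_def closure_sequential by blast
    have "span E \<subseteq> span {e. \<exists>\<sigma>\<le>c. T e = \<sigma> *\<^sub>R e}" unfolding E_def by (intro span_mono) auto
    then have "b (T (x n)) (x n) \<le> c * b (x n) (x n)" for n
      using x(1) rayleigh_le_on_span_eigenvectors by blast
    moreover have "(\<lambda>n. b (T (x n)) (x n)) \<longlonglongrightarrow> b (T v) v"
      by (intro tendsto T.tendsto x)
    moreover have "(\<lambda>n. c * b (x n) (x n)) \<longlonglongrightarrow> c * b v v"
      by (intro tendsto_mult_left tendsto x)
    ultimately show ?thesis by (intro LIMSEQ_le) auto
  qed
  define W' where "W' = W \<inter> (\<Inter>e\<in>E. {w. b w e = 0})"
  have "subspace W'"
    using W(1) unfolding W'_def subspace_def by (auto simp: zero_left add_left scaleR_left)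
  moreover have "closed W'"
    unfolding W'_def
    by (intro closed_Int W closed_INT ballI closed_Collect_eq continuous_intros
        linear_continuous_on bounded_linear_left)
  moreover have "T ` W' \<subseteq> W'"
    using W(3) unfolding W'_def E_def by (auto simp: selfadj scaleR_right)
  moreover have "\<exists>w\<in>W'. w \<noteq> 0"
  proof -
    obtain u where u: "u \<in> V" "\<And>h. h \<in> V \<Longrightarrow> b (f - u) h = 0" using projection_exists[OF V] by blast
    then have "f - u \<in> W'"
      using \<open>E \<subseteq> V\<close> \<open>V \<subseteq> W\<close> f(1) W(1) unfolding W'_def by (auto intro: subspace_diff)
    moreover have "f \<noteq> u" using rV u(1) f(2) by fastforce
    ultimately show ?thesis by (intro bexI[of _ "f - u"]) auto
  qed
  ultimately obtain e \<tau> where e: "e \<in> W'" "e \<noteq> 0" "T e = \<tau> *\<^sub>R e"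
    using eigenvector_exists by meson
  \<comment> \<open>A member of \<open>E\<close> in \<open>W'\<close> would be orthogonal to itself,
    so the eigenvalue found in \<open>W'\<close> cannot be at most \<open>c\<close>.\<close>
  have "e \<notin> E" using e self_pos[of e] unfolding W'_def by force
  then have "\<tau> > c" using e unfolding W'_def E_def by force
  with e show ?thesis unfolding W'_def by blast
qed

end

section \<open>Orthonormal families and the trace\<close>

definition linear_dim :: "'a::real_vector set \<Rightarrow> enat" where
  "linear_dim E = (if \<exists>Q. finite Q \<and> E \<subseteq> span Q then enat (dim E) else \<infinity>)"

lemma gen_multiplicity_eq: "gen_multiplicity A B \<tau> = linear_dim (gen_eigenspace A B \<tau>)"
  by (simp add: gen_multiplicity_def linear_dim_def)

lemma linear_dim_le_card:
  assumes "finite Q" "E \<subseteq> span Q"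
  shows "linear_dim E \<le> enat (card Q)"
  using assms dim_le_card[of E Q] unfolding linear_dim_def by auto

lemma independent_card_le_linear_dim:
  assumes "independent Q" "finite Q" "Q \<subseteq> E"
  shows "enat (card Q) \<le> linear_dim E"
proof (cases "\<exists>P. finite P \<and> E \<subseteq> span P")
  case True
  then obtain P where P: "finite P" "E \<subseteq> span P" by blast
  obtain C where C: "C \<subseteq> E" "independent C" "E \<subseteq> span C" "card C = dim E"
    using basis_exists[of E] .
  have "finite C" using independent_span_bound[OF P(1) C(2)] C(1) P(2) by blast
  then have "card Q \<le> card C" using independent_span_bound[OF _ assms(1)] assms(3) C(3) by blast
  with True C(4) show ?thesis unfolding linear_dim_def by simp
next
  case False
  then show ?thesis unfolding linear_dim_def by (simp only: if_False enat_ord_code)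
qed

context coercive_form
begin

text \<open>Indexed families match the tuples of the problem; a set of vectors is treated as the
  family indexed by itself through \<open>\<lambda>x. x\<close>.\<close>

definition orthonormal :: "'i set \<Rightarrow> ('i \<Rightarrow> 'h) \<Rightarrow> bool" where
  "orthonormal I f \<longleftrightarrow> (\<forall>i\<in>I. \<forall>j\<in>I. b (f i) (f j) = (if i = j then 1 else 0))"

definition proj :: "'i set \<Rightarrow> ('i \<Rightarrow> 'h) \<Rightarrow> 'h \<Rightarrow> 'h" where
  "proj I f x = (\<Sum>i\<in>I. b x (f i) *\<^sub>R f i)"

lemma orthonormal_subset: "orthonormal I f \<Longrightarrow> J \<subseteq> I \<Longrightarrow> orthonormal J f"
  unfolding orthonormal_def by blast

lemma proj_in_span: "proj I f x \<in> span (f ` I)"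
  unfolding proj_def by (intro span_sum span_mul span_base) simp

lemma inner_proj:
  assumes "finite I" "orthonormal I f" "j \<in> I"
  shows "b (proj I f x) (f j) = b x (f j)"
proof -
  have "b (proj I f x) (f j) = (\<Sum>i\<in>I. b x (f i) * b (f i) (f j))"
    by (simp add: proj_def sum_left scaleR_left)
  also have "\<dots> = (\<Sum>i\<in>I. if i = j then b x (f j) else 0)"
    using assms by (intro sum.cong) (auto simp: orthonormal_def)
  finally show ?thesis using assms by simp
qed

lemma residual_orthogonal:
  assumes "finite I" "orthonormal I f" "j \<in> I"
  shows "b (x - proj I f x) (f j) = 0"
  using inner_proj[OF assms] by (simp add: diff_left)

lemma orthogonal_span:
  assumes "\<And>i. i \<in> I \<Longrightarrow> b h (f i) = 0" "y \<in> span (f ` I)"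
  shows "b h y = 0"
  using assms(2) by (induction rule: span_induct_alt) (auto simp: zero_right add_right scaleR_right assms(1))

lemma pythagoras_proj:
  assumes "finite I" "orthonormal I f"
  shows "b x x = (\<Sum>i\<in>I. (b x (f i))\<^sup>2) + b (x - proj I f x) (x - proj I f x)"
proof -
  have *: "b (x - proj I f x) (proj I f x) = 0"
    by (rule orthogonal_span[OF residual_orthogonal[OF assms] proj_in_span])
  then have "b (x - proj I f x) (x - proj I f x) = b x (x - proj I f x)"
    by (simp add: diff_right diff_left sym[of x "proj I f x"])
  also have "\<dots> = b x x - (\<Sum>i\<in>I. (b x (f i))\<^sup>2)"
    by (simp add: proj_def diff_right sum_right scaleR_right power2_eq_square)
  finally show ?thesis by simp
qed

lemma bessel:
  assumes "finite I" "orthonormal I f"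
  shows "(\<Sum>i\<in>I. (b x (f i))\<^sup>2) \<le> b x x"
  using pythagoras_proj[OF assms, of x] self_nonneg[of "x - proj I f x"] by simp

lemma proj_span:
  assumes "finite I" "orthonormal I f" "x \<in> span (f ` I)"
  shows "proj I f x = x"
proof -
  have "x - proj I f x \<in> span (f ` I)" using assms(3) proj_in_span by (rule span_diff)
  with residual_orthogonal[OF assms(1,2)] have "b (x - proj I f x) (x - proj I f x) = 0"
    by (rule orthogonal_span)
  then show ?thesis by simp
qed

text \<open>The vectors \<open>x\<close> and \<open>x - y\<close> have the same residual, since
  \<open>y\<close> is its own projection; Pythagoras for \<open>x - y\<close> exhibits the excess as
  a sum of squares.\<close>

lemma proj_nearest:
  assumes "finite I" "orthonormal I f" "y \<in> span (f ` I)"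
  shows "b (x - proj I f x) (x - proj I f x) \<le> b (x - y) (x - y)"
proof -
  have "proj I f (x - y) = proj I f x - proj I f y"
    by (simp add: proj_def diff_left scaleR_diff_left sum_subtractf)
  then have "proj I f (x - y) = proj I f x - y" using proj_span[OF assms] by simp
  then have "b (x - y) (x - y) = (\<Sum>i\<in>I. (b (x - y) (f i))\<^sup>2) + b (x - proj I f x) (x - proj I f x)"
    using pythagoras_proj[OF assms(1,2), of "x - y"] by simp
  then show ?thesis by (simp add: sum_nonneg)
qed

lemma orthonormal_inj_on: "orthonormal I f \<Longrightarrow> inj_on f I"
  unfolding orthonormal_def inj_on_def by (metis (full_types) zero_neq_one)

lemma orthonormal_independent:
  assumes "finite I" "orthonormal I f"
  shows "independent (f ` I)"
proof
  assume "dependent (f ` I)"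
  then obtain j where j: "j \<in> I" "f j \<in> span (f ` I - {f j})" unfolding dependent_def by blast
  have "f ` I - {f j} \<subseteq> f ` (I - {j})" by blast
  then have "f j \<in> span (f ` (I - {j}))" using j(2) span_mono by blast
  moreover have "b (f j) (f i) = 0" if "i \<in> I - {j}" for i
    using assms j that by (auto simp: orthonormal_def)
  ultimately have "b (f j) (f j) = 0" using orthogonal_span by blast
  with assms(2) j(1) show False by (simp add: orthonormal_def)
qed

lemma orthonormal_card_le_linear_dim:
  assumes "finite I" "orthonormal I f" "f ` I \<subseteq> E"
  shows "enat (card I) \<le> linear_dim E"
  using independent_card_le_linear_dim[OF orthonormal_independent[OF assms(1,2)] _ assms(3)]
    card_image[OF orthonormal_inj_on[OF assms(2)]] assms(1) by simp

lemma orthonormal_insert: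
  assumes "orthonormal I f" "i \<notin> I" "\<And>j. j \<in> I \<Longrightarrow> b h (f j) = 0" "h \<noteq> 0"
  shows "orthonormal (insert i I) (f(i := (1 / sqrt (b h h)) *\<^sub>R h))"
proof -
  have "b (f j) h = 0" if "j \<in> I" for j using assms(3)[OF that] sym by metis
  then show ?thesis
    using assms self_pos[OF assms(4)]
    unfolding orthonormal_def by (auto simp: scaleR_left scaleR_right)
qed

text \<open>Gram-Schmidt: while fewer vectors are chosen than the dimension allows, their span does
  not contain \<open>E\<close>. The argument also covers \<open>E\<close> of infinite
  dimension.\<close>

lemma orthonormal_family_exists:
  assumes "finite I" "subspace E" "enat (card I) \<le> linear_dim E"
  shows "\<exists>f. orthonormal I f \<and> f ` I \<subseteq> E"
  using assms(1,3)
proof (induction I rule: finite_induct)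
  case empty
  then show ?case by (simp add: orthonormal_def)
next
  case (insert i I)
  then have "enat (card I) \<le> linear_dim E"
    by (metis card_insert_disjoint enat_ord_simps(1) le_SucI order_refl order_trans)
  then obtain f where f: "orthonormal I f" "f ` I \<subseteq> E" using insert.IH by blast
  have "\<not> E \<subseteq> span (f ` I)"
  proof
    assume "E \<subseteq> span (f ` I)"
    then have "linear_dim E \<le> enat (card (f ` I))" using insert(1) by (intro linear_dim_le_card) auto
    also have "\<dots> < enat (card (insert i I))" using insert(1,2) card_image_le[of I f] by simp
    finally show False using insert.prems by simp
  qed
  then obtain x where x: "x \<in> E" "x \<notin> span (f ` I)" by blast
  define h where "h = x - proj I f x"
  have "h \<noteq> 0" using x(2) proj_in_span[of I f x] by (auto simp: h_def)
  have "span (f ` I) \<subseteq> E" using f(2) assms(2) by (rule span_minimal)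
  then have "h \<in> E" unfolding h_def using proj_in_span x(1) assms(2) by (blast intro: subspace_diff)
  have "orthonormal (insert i I) (f(i := (1 / sqrt (b h h)) *\<^sub>R h))"
    using residual_orthogonal[OF insert(1) f(1)] \<open>h \<noteq> 0\<close> insert(2) f(1)
    by (intro orthonormal_insert) (auto simp: h_def)
  moreover have "(f(i := (1 / sqrt (b h h)) *\<^sub>R h)) ` insert i I \<subseteq> E"
    using f(2) \<open>h \<in> E\<close> assms(2) by (auto intro: subspace_mul)
  ultimately show ?case by blast
qed

lemma parseval_span:
  assumes "finite I" "orthonormal I g" "x \<in> span (g ` I)"
  shows "(\<Sum>i\<in>I. (b x (g i))\<^sup>2) = b x x"
  using pythagoras_proj[OF assms(1,2), of x] proj_span[OF assms] by (simp add: zero_left)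

end

section \<open>Ky Fan's trace principle: eigenfamilies maximize the trace\<close>

context compact_selfadjoint
begin

definition eigenspace :: "real \<Rightarrow> 'h set" where
  "eigenspace \<tau> = {f. T f = \<tau> *\<^sub>R f}"

lemma subspace_eigenspace: "subspace (eigenspace \<tau>)"
  unfolding eigenspace_def subspace_def by (auto simp: T.zero T.add T.scaleR scaleR_add_right)

text \<open>Orthonormal families are chosen separately in each eigenspace, indexed by the fibre of
  \<tau> over the eigenvalue; across fibres orthogonality is automatic.\<close>

lemma eigenfamily_exists:
  assumes "finite I" "\<And>\<sigma>. enat (card {i\<in>I. \<tau> i = \<sigma>}) \<le> linear_dim (eigenspace \<sigma>)"
  shows "\<exists>f. orthonormal I f \<and> (\<forall>i\<in>I. f i \<in> eigenspace (\<tau> i))"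
proof -
  have "\<exists>g. orthonormal {i\<in>I. \<tau> i = \<sigma>} g \<and> g ` {i\<in>I. \<tau> i = \<sigma>} \<subseteq> eigenspace \<sigma>" for \<sigma>
    using assms by (intro orthonormal_family_exists subspace_eigenspace) auto
  then obtain g where g: "\<And>\<sigma>. orthonormal {i\<in>I. \<tau> i = \<sigma>} (g \<sigma>)"
    "\<And>\<sigma>. g \<sigma> ` {i\<in>I. \<tau> i = \<sigma>} \<subseteq> eigenspace \<sigma>" by metis
  define f where "f i = g (\<tau> i) i" for i
  have ev: "f i \<in> eigenspace (\<tau> i)" if "i \<in> I" for i using g(2)[of "\<tau> i"] that unfolding f_def by blast
  have "b (f i) (f j) = (if i = j then 1 else 0)" if "i \<in> I" "j \<in> I" for i j
  proof (cases "\<tau> i = \<tau> j")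
    case True
    then show ?thesis using g(1)[of "\<tau> i"] that unfolding f_def orthonormal_def by simp
  next
    case False
    then show ?thesis
      using ev[OF that(1)] ev[OF that(2)] unfolding eigenspace_def by (auto intro: eigenvectors_orthogonal)
  qed
  with ev show ?thesis unfolding orthonormal_def by blast
qed

text \<open>The span of the eigenvectors is invariant, and so, by selfadjointness, is its
  complement; hence there are no cross terms.\<close>

lemma rayleigh_proj_eigenfamily:
  assumes "finite I" "orthonormal I f" "\<And>i. i \<in> I \<Longrightarrow> f i \<in> eigenspace (\<tau> i)"
  shows "b (T x) x = (\<Sum>i\<in>I. \<tau> i * (b x (f i))\<^sup>2)
    + b (T (x - proj I f x)) (x - proj I f x)"
proof -
  define h where "h = x - proj I f x"
  define u where "u = proj I f x"
  have Tu: "T u = (\<Sum>i\<in>I. (\<tau> i * b x (f i)) *\<^sub>R f i)"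
    unfolding u_def proj_def T.sum T.scaleR
    using assms(3) by (intro sum.cong) (auto simp: eigenspace_def)
  have orth: "b (f i) h = 0" if "i \<in> I" for i
    using residual_orthogonal[OF assms(1,2) that, of x] by (simp add: h_def sym)
  have Tuh: "b (T u) h = 0" unfolding Tu by (simp add: sum_left scaleR_left orth)
  then have "b (T h) u = 0" by (metis selfadj sym)
  moreover have "b (T u) u = (\<Sum>i\<in>I. \<tau> i * (b x (f i))\<^sup>2)"
  proof -
    have "b (f i) u = b x (f i)" if "i \<in> I" for i
      unfolding u_def using inner_proj[OF assms(1,2) that] by (simp add: sym)
    then show ?thesis unfolding Tu by (simp add: sum_left scaleR_left power2_eq_square mult.assoc)
  qed
  moreover have "x = u + h" by (simp add: u_def h_def)
  then have "b (T x) x = b (T u) u + b (T u) h + b (T h) u + b (T h) h"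
    by (simp add: T.add add_left add_right)
  ultimately show ?thesis using Tuh unfolding h_def by simp
qed

text \<open>Each \<open>g i\<close> contributes at most \<open>c\<close> plus the excesses
  \<open>\<tau> j - c\<close> weighted by squared coefficients. Bessel for \<open>g\<close>, applied
  to \<open>f j\<close>, bounds the total weight on each \<open>j\<close> by 1. Splitting off
  \<open>c\<close> makes the excesses nonnegative, as this last bound requires.\<close>

lemma trace_le_eigenfamily:
  assumes "finite I" "orthonormal I f" "\<And>i. i \<in> I \<Longrightarrow> f i \<in> eigenspace (\<tau> i)"
    and c: "\<And>i. i \<in> I \<Longrightarrow> c \<le> \<tau> i"
    and comp: "\<And>h. (\<And>i. i \<in> I \<Longrightarrow> b h (f i) = 0) \<Longrightarrow> b (T h) h \<le> c * b h h"
    and g: "orthonormal I g"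
  shows "(\<Sum>i\<in>I. b (T (g i)) (g i)) \<le> (\<Sum>i\<in>I. b (T (f i)) (f i))"
proof -
  have "b (T (g i)) (g i) \<le> c + (\<Sum>j\<in>I. (\<tau> j - c) * (b (g i) (f j))\<^sup>2)" if "i \<in> I" for i
  proof -
    define h where "h = g i - proj I f (g i)"
    have "b (T (g i)) (g i) = (\<Sum>j\<in>I. \<tau> j * (b (g i) (f j))\<^sup>2) + b (T h) h"
      unfolding h_def using assms(1-3) by (rule rayleigh_proj_eigenfamily)
    also have "b (T h) h \<le> c * b h h"
      using comp residual_orthogonal[OF assms(1,2)] unfolding h_def by blast
    also have "b h h = 1 - (\<Sum>j\<in>I. (b (g i) (f j))\<^sup>2)"
      using pythagoras_proj[OF assms(1,2), of "g i"] g that unfolding h_def orthonormal_def by simp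
    finally show ?thesis
      by (simp add: left_diff_distrib sum_subtractf sum_distrib_left algebra_simps)
  qed
  then have "(\<Sum>i\<in>I. b (T (g i)) (g i)) \<le> (\<Sum>i\<in>I. c + (\<Sum>j\<in>I. (\<tau> j - c) * (b (g i) (f j))\<^sup>2))"
    by (rule sum_mono)
  also have "\<dots> = (\<Sum>i\<in>I. c) + (\<Sum>j\<in>I. (\<tau> j - c) * (\<Sum>i\<in>I. (b (f j) (g i))\<^sup>2))"
    unfolding sum.distrib sum_distrib_left by (subst sum.swap) (simp add: sym)
  also have "\<dots> \<le> (\<Sum>i\<in>I. c) + (\<Sum>j\<in>I. (\<tau> j - c) * 1)"
  proof (intro add_left_mono sum_mono mult_left_mono)
    show "(\<Sum>i\<in>I. (b (f j) (g i))\<^sup>2) \<le> 1" if "j \<in> I" for j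
      using bessel[OF assms(1) g, of "f j"] assms(2) that by (simp add: orthonormal_def)
  qed (use c in auto)
  also have "\<dots> = (\<Sum>j\<in>I. \<tau> j)" by (simp add: sum_subtractf)
  also have "\<dots> = (\<Sum>i\<in>I. b (T (f i)) (f i))"
    using assms(2,3) by (intro sum.cong) (auto simp: eigenspace_def orthonormal_def scaleR_left)
  finally show ?thesis .
qed

definition largest_eigenvalues :: "'i set \<Rightarrow> ('i \<Rightarrow> real) \<Rightarrow> bool" where
  "largest_eigenvalues I \<tau> \<longleftrightarrow>
     (\<forall>\<sigma>. enat (card {i\<in>I. \<tau> i = \<sigma>}) \<le> linear_dim (eigenspace \<sigma>)) \<and>
     (\<forall>\<sigma>. (\<exists>i\<in>I. \<tau> i < \<sigma>) \<longrightarrow> enat (card {i\<in>I. \<tau> i = \<sigma>}) = linear_dim (eigenspace \<sigma>))"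

text \<open>It suffices to bound the Rayleigh quotient by the least listed eigenvalue
  \<open>c\<close> on the complement of the family. A larger value there would yield an eigenvector
  for some \<sigma> above \<open>c\<close> orthogonal to the family, one more than the multiplicity
  of \<sigma>, which the list already exhausts.\<close>

theorem largest_eigenfamily_maximizes_trace:
  assumes I: "finite I" and \<tau>: "largest_eigenvalues I \<tau>"
    and f: "orthonormal I f" "\<And>i. i \<in> I \<Longrightarrow> f i \<in> eigenspace (\<tau> i)"
    and g: "orthonormal I g"
  shows "(\<Sum>i\<in>I. b (T (g i)) (g i)) \<le> (\<Sum>i\<in>I. b (T (f i)) (f i))"
proof (cases "I = {}")
  case False
  define c where "c = Min (\<tau> ` I)"
  have c: "c \<le> \<tau> i" if "i \<in> I" for i unfolding c_def using I that by simp
  have "c \<in> \<tau> ` I" unfolding c_def using I False by simp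
  then obtain k where k: "k \<in> I" "\<tau> k = c" by blast
  define W where "W = (\<Inter>i\<in>I. {h. b h (f i) = 0})"
  have "subspace W" unfolding W_def subspace_def by (auto simp: zero_left add_left scaleR_left)
  moreover have "closed W"
    unfolding W_def by (intro closed_INT ballI closed_Collect_eq continuous_intros
        linear_continuous_on bounded_linear_left)
  moreover have "T ` W \<subseteq> W"
    using f(2) unfolding W_def eigenspace_def by (auto simp: selfadj scaleR_right)
  ultimately have large: "\<exists>e\<in>W. e \<noteq> 0 \<and> (\<exists>\<tau>>c. T e = \<tau> *\<^sub>R e)" if "h \<in> W" "b (T h) h > c * b h h" for h
    using that by (intro large_eigenvalue_exists)
  have "b (T h) h \<le> c * b h h" if "\<And>i. i \<in> I \<Longrightarrow> b h (f i) = 0" for h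
  proof (rule ccontr)
    assume "\<not> b (T h) h \<le> c * b h h"
    moreover have "h \<in> W" using that unfolding W_def by blast
    ultimately obtain e \<sigma> where e: "e \<in> W" "e \<noteq> 0" "\<sigma> > c" "T e = \<sigma> *\<^sub>R e"
      using large[of h] by (auto simp: not_le)
    define J where "J = {i\<in>I. \<tau> i = \<sigma>}"
    have J: "orthonormal J f" "J \<subseteq> I" "finite J"
      unfolding J_def using f(1) I by (auto intro: orthonormal_subset)
    \<comment> \<open>The index attaining the minimum is free to carry the additional eigenvector,
      its own eigenvalue being \<open>c < \<sigma>\<close>.\<close>
    have "k \<notin> J" using k e(3) by (simp add: J_def)
    define f' where "f' = f(k := (1 / sqrt (b e e)) *\<^sub>R e)"
    have "orthonormal (insert k J) f'"
      unfolding f'_def using J e \<open>k \<notin> J\<close> by (intro orthonormal_insert) (auto simp: W_def)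
    moreover have "f' i \<in> eigenspace \<sigma>" if "i \<in> insert k J" for i
      using that f(2)[of i] e(4) \<open>k \<notin> J\<close> unfolding f'_def J_def
      by (auto simp: eigenspace_def T.scaleR)
    ultimately have "enat (card (insert k J)) \<le> linear_dim (eigenspace \<sigma>)"
      using J(3) by (intro orthonormal_card_le_linear_dim) auto
    also have "\<dots> = enat (card J)"
      using \<tau> k e(3) unfolding largest_eigenvalues_def J_def by metis
    finally show False using J(3) \<open>k \<notin> J\<close> by simp
  qed
  then show ?thesis using trace_le_eigenfamily[OF I f _ _ g] c by blast
qed simp

section \<open>The converse: the span of a trace maximizer carries the largest eigenvalues\<close>

lemma continuous_on_proj: "continuous_on UNIV (proj I f)"
  unfolding proj_def
  by (intro continuous_intros linear_continuous_on bounded_linear_left)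

text \<open>The span is the fixed-point set of the continuous map \<open>proj I f\<close>.
  Closedness allows the search for eigenvectors inside it.\<close>

lemma closed_span_orthonormal:
  assumes "finite I" "orthonormal I f"
  shows "closed (span (f ` I))"
proof -
  have "span (f ` I) = {x. proj I f x = x}"
    using proj_span[OF assms] proj_in_span[of I f] by (auto, metis)
  then show ?thesis
    by (simp only:) (intro closed_Collect_eq continuous_on_proj continuous_on_id)
qed

lemma span_orthonormal_not_subset:
  assumes "finite I" "orthonormal I g" "finite J" "card J < card I"
  shows "\<not> span (g ` I) \<subseteq> span (f ` J)"
proof
  assume "span (g ` I) \<subseteq> span (f ` J)"
  with span_superset have "g ` I \<subseteq> span (f ` J)" by (rule order_trans)
  then have "card (g ` I) \<le> card (f ` J)"
    using independent_span_bound[OF finite_imageI[OF assms(3)] orthonormal_independent[OF assms(1,2)]]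
    by simp
  also have "\<dots> \<le> card J" using assms(3) by (rule card_image_le)
  finally show False
    using card_image[OF orthonormal_inj_on[OF assms(2)]] assms(4) by simp
qed

lemma span_orthonormal_subset:
  assumes "finite I" "orthonormal I f" "finite J" "card J \<le> card I" "f ` I \<subseteq> span (g ` J)"
  shows "span (g ` J) \<subseteq> span (f ` I)"
proof
  fix x assume x: "x \<in> span (g ` J)"
  show "x \<in> span (f ` I)"
  proof (rule ccontr)
    assume nx: "x \<notin> span (f ` I)"
    then have "x \<notin> f ` I" using span_base[of x "f ` I"] by blast
    then have "Suc (card I) = card (insert x (f ` I))"
      using card_image[OF orthonormal_inj_on[OF assms(2)]] assms(1) by simp
    also have "\<dots> \<le> card (g ` J)"
    proof -
      have "independent (insert x (f ` I))"
        using orthonormal_independent[OF assms(1,2)] nx by (rule independent_insertI[rotated])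
      moreover have "insert x (f ` I) \<subseteq> span (g ` J)" using assms(5) x by blast
      ultimately show ?thesis
        using independent_span_bound[OF finite_imageI[OF assms(3)], of "insert x (f ` I)"] by simp
    qed
    also have "\<dots> \<le> card J" using assms(3) by (rule card_image_le)
    finally show False using assms(4) by simp
  qed
qed

text \<open>Deflation: \<open>eigenvector_exists\<close> is applied to the part of the span
  orthogonal to the eigenvectors already found. That part is closed and invariant, and a dimension
  count keeps it nonzero while \<open>card J < card I\<close>.\<close>

lemma diagonalize_invariant_span:
  assumes I: "finite I" and g: "orthonormal I g" and inv: "T ` span (g ` I) \<subseteq> span (g ` I)"
  shows "\<exists>f \<tau>. orthonormal I f \<and> f ` I \<subseteq> span (g ` I) \<and> (\<forall>i\<in>I. f i \<in> eigenspace (\<tau> i))"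
proof -
  have "\<exists>f \<tau>. orthonormal J f \<and> f ` J \<subseteq> span (g ` I) \<and> (\<forall>i\<in>J. f i \<in> eigenspace (\<tau> i))"
    if "finite J" "J \<subseteq> I" for J
    using that
  proof (induction J rule: finite_induct)
    case empty
    then show ?case by (simp add: orthonormal_def)
  next
    case (insert i J)
    then obtain f \<tau> where f: "orthonormal J f" "f ` J \<subseteq> span (g ` I)"
      "\<And>i. i \<in> J \<Longrightarrow> f i \<in> eigenspace (\<tau> i)" by blast
    have "J \<subset> I" using insert by blast
    then have "card J < card I" using I by (rule psubset_card_mono[rotated])
    then obtain x where x: "x \<in> span (g ` I)" "x \<notin> span (f ` J)"
      using span_orthonormal_not_subset[OF I g insert(1)] by blast
    define W where "W = span (g ` I) \<inter> (\<Inter>j\<in>J. {h. b h (f j) = 0})"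
    have "subspace W"
      unfolding W_def subspace_def
      by (auto simp: zero_left add_left scaleR_left span_zero span_add span_mul)
    moreover have "closed W"
      unfolding W_def
      by (intro closed_Int closed_span_orthonormal I g closed_INT ballI closed_Collect_eq continuous_intros
          linear_continuous_on bounded_linear_left)
    moreover have "T ` W \<subseteq> W"
      using f(3) inv unfolding W_def eigenspace_def by (auto simp: selfadj scaleR_right)
    moreover have "x - proj J f x \<in> W"
      using x(1) proj_in_span[of J f x] span_minimal[OF f(2) subspace_span]
        residual_orthogonal[OF insert(1) f(1)]
      unfolding W_def by (auto intro: span_diff)
    moreover have "x - proj J f x \<noteq> 0" using x(2) proj_in_span[of J f x] by auto
    ultimately obtain e \<sigma> where e: "e \<in> W" "e \<noteq> 0" "T e = \<sigma> *\<^sub>R e"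
      using eigenvector_exists by meson
    define f' where "f' = f(i := (1 / sqrt (b e e)) *\<^sub>R e)"
    define \<tau>' where "\<tau>' = \<tau>(i := \<sigma>)"
    have "orthonormal (insert i J) f'"
      unfolding f'_def using insert(2) f(1) e by (intro orthonormal_insert) (auto simp: W_def)
    moreover have "f' ` insert i J \<subseteq> span (g ` I)"
      using f(2) e(1) insert(2) unfolding f'_def W_def by (auto intro: span_mul)
    moreover have "f' j \<in> eigenspace (\<tau>' j)" if "j \<in> insert i J" for j
      using that f(3) e(3) insert(2) unfolding f'_def \<tau>'_def by (auto simp: eigenspace_def T.scaleR)
    ultimately show ?case by blast
  qed
  with I show ?thesis by blast
qed

text \<open>A competitor that differs only in position \<open>i\<close> leaves the other terms of
  the trace unchanged, so optimality compares the Rayleigh quotients of \<open>v\<close> and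
  \<open>g i\<close> alone.\<close>

lemma trace_maximizer_swap:
  assumes I: "finite I" and g: "orthonormal I g"
    and max: "\<And>f. orthonormal I f \<Longrightarrow> (\<Sum>i\<in>I. b (T (f i)) (f i)) \<le> (\<Sum>i\<in>I. b (T (g i)) (g i))"
    and i: "i \<in> I" and v: "\<And>j. j \<in> I - {i} \<Longrightarrow> b v (g j) = 0"
  shows "b (T v) v \<le> b (T (g i)) (g i) * b v v"
proof (cases "v = 0")
  case False
  define g' where "g' = g(i := (1 / sqrt (b v v)) *\<^sub>R v)"
  have "orthonormal (insert i (I - {i})) g'"
    unfolding g'_def using False v
    by (intro orthonormal_insert orthonormal_subset[OF g]) auto
  then have "orthonormal I g'" using i by (simp add: insert_absorb)
  then have "(\<Sum>j\<in>I. b (T (g' j)) (g' j)) \<le> (\<Sum>j\<in>I. b (T (g j)) (g j))" by (rule max)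
  moreover have "(\<Sum>j\<in>I - {i}. b (T (g' j)) (g' j)) = (\<Sum>j\<in>I - {i}. b (T (g j)) (g j))"
    by (intro sum.cong) (auto simp: g'_def)
  ultimately have "b (T (g' i)) (g' i) \<le> b (T (g i)) (g i)"
    using I i by (simp add: sum.remove)
  moreover have "b (T (g' i)) (g' i) = b (T v) v / b v v"
    using self_pos[OF False] by (simp add: g'_def T.scaleR scaleR_left scaleR_right)
  ultimately show ?thesis using self_pos[OF False] by (simp add: field_simps)
qed (simp add: zero_right)

text \<open>First variation: tilting \<open>g i\<close> towards a vector orthogonal to the whole family cannot increase
  the trace.\<close>

lemma trace_maximizer_invariant:
  assumes I: "finite I" and g: "orthonormal I g"
    and max: "\<And>f. orthonormal I f \<Longrightarrow> (\<Sum>i\<in>I. b (T (f i)) (f i)) \<le> (\<Sum>i\<in>I. b (T (g i)) (g i))"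
  shows "T ` span (g ` I) \<subseteq> span (g ` I)"
proof -
  have "T (g i) \<in> span (g ` I)" if i: "i \<in> I" for i
  proof -
    define h where "h = T (g i) - proj I g (T (g i))"
    have orth: "b h (g j) = 0" if "j \<in> I" for j
      unfolding h_def using residual_orthogonal[OF I g that] .
    have "0 \<le> 2 * t * (- b (T (g i)) h) + t\<^sup>2 * (b (T (g i)) (g i) * b h h - b (T h) h)" for t
    proof -
      have "b (g i + t *\<^sub>R h) (g j) = 0" if "j \<in> I - {i}" for j
        using that i g orth[of j] by (auto simp: add_left scaleR_left orthonormal_def)
      from trace_maximizer_swap[OF I g max i this]
      have "b (T (g i + t *\<^sub>R h)) (g i + t *\<^sub>R h)
        \<le> b (T (g i)) (g i) * b (g i + t *\<^sub>R h) (g i + t *\<^sub>R h)" by blast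
      moreover have "b (g i + t *\<^sub>R h) (g i + t *\<^sub>R h) = 1 + t\<^sup>2 * b h h"
        using g i orth[OF i] sym[of "g i" h]
        by (simp add: add_left add_right scaleR_left scaleR_right orthonormal_def power2_eq_square)
      moreover have "b (T (g i + t *\<^sub>R h)) (g i + t *\<^sub>R h)
        = b (T (g i)) (g i) + 2 * t * b (T (g i)) h + t\<^sup>2 * b (T h) h"
        by (simp add: T.add T.scaleR add_left add_right scaleR_left scaleR_right power2_eq_square
            selfadj[of h "g i"] sym[of h "T (g i)"] algebra_simps)
      ultimately show ?thesis by (simp add: algebra_simps)
    qed
    \<comment> \<open>The vanishing first-order term makes \<open>h\<close> orthogonal to
      \<open>T (g i)\<close>, of which it is the residual; hence \<open>h\<close> is orthogonal to
      itself.\<close>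
    from linear_coeff_zero[OF this] have "b (T (g i)) h = 0" by simp
    moreover have "b h (proj I g (T (g i))) = 0" using orth proj_in_span by (rule orthogonal_span)
    moreover have "b h h = b h (T (g i)) - b h (proj I g (T (g i)))"
      by (subst (2) h_def) (rule diff_right)
    ultimately have "b h h = 0" using sym[of h "T (g i)"] by simp
    then have "T (g i) = proj I g (T (g i))" by (simp add: h_def)
    then show ?thesis using proj_in_span by metis
  qed
  then have "span (T ` g ` I) \<subseteq> span (g ` I)" by (intro span_minimal subspace_span) auto
  then show ?thesis by (simp add: linear_span_image[OF T.linear_axioms])
qed

text \<open>The trace over an invariant span does not depend on the orthonormal basis, so the
  diagonalizing family \<open>f\<close> is again a maximizer. If \<sigma> exceeds
  \<open>\<tau> i\<close>, swapping a nonzero eigenvector for \<sigma> orthogonal to all of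
  \<open>f\<close> into position \<open>i\<close> would increase the trace; hence the members of
  \<open>f\<close> with eigenvalue \<sigma> already span its eigenspace.\<close>

theorem trace_maximizer_largest_eigenvalues:
  assumes I: "finite I" and g: "orthonormal I g"
    and max: "\<And>f. orthonormal I f \<Longrightarrow> (\<Sum>i\<in>I. b (T (f i)) (f i)) \<le> (\<Sum>i\<in>I. b (T (g i)) (g i))"
  shows "\<exists>\<tau>. largest_eigenvalues I \<tau>"
proof -
  obtain f \<tau> where f: "orthonormal I f" "f ` I \<subseteq> span (g ` I)"
    and ev: "\<And>i. i \<in> I \<Longrightarrow> f i \<in> eigenspace (\<tau> i)"
    using diagonalize_invariant_span[OF I g trace_maximizer_invariant[OF I g max]] by blast
  have sub: "span (g ` I) \<subseteq> span (f ` I)"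
    using span_orthonormal_subset[OF I f(1) I _ f(2)] by simp
  have q: "b (T (f i)) (f i) = \<tau> i" if "i \<in> I" for i
    using f(1) ev[OF that] that by (simp add: eigenspace_def orthonormal_def scaleR_left)
  have "(\<Sum>i\<in>I. b (T (g i)) (g i)) = (\<Sum>i\<in>I. \<Sum>j\<in>I. \<tau> j * (b (g i) (f j))\<^sup>2)"
  proof (rule sum.cong)
    fix i assume "i \<in> I"
    then have "g i \<in> span (f ` I)" using sub span_base by blast
    then have "proj I f (g i) = g i" by (rule proj_span[OF I f(1)])
    then show "b (T (g i)) (g i) = (\<Sum>j\<in>I. \<tau> j * (b (g i) (f j))\<^sup>2)"
      using rayleigh_proj_eigenfamily[OF I f(1) ev, of "g i"] by (simp add: zero_right)
  qed simp
  also have "\<dots> = (\<Sum>j\<in>I. \<tau> j * (\<Sum>i\<in>I. (b (f j) (g i))\<^sup>2))"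
    unfolding sum_distrib_left by (subst sum.swap) (simp add: sym)
  \<comment> \<open>Since \<open>f j\<close> lies in the span of \<open>g\<close>, Parseval gives
    its weight exactly, where Bessel would only bound it.\<close>
  also have "\<dots> = (\<Sum>j\<in>I. b (T (f j)) (f j))"
  proof (rule sum.cong)
    fix j assume "j \<in> I"
    then have "f j \<in> span (g ` I)" using f(2) by blast
    then have "(\<Sum>i\<in>I. (b (f j) (g i))\<^sup>2) = b (f j) (f j)" by (rule parseval_span[OF I g])
    then show "\<tau> j * (\<Sum>i\<in>I. (b (f j) (g i))\<^sup>2) = b (T (f j)) (f j)"
      using q[OF \<open>j \<in> I\<close>] f(1) \<open>j \<in> I\<close> by (simp add: orthonormal_def)
  qed simp
  finally have maxf: "(\<Sum>i\<in>I. b (T (f' i)) (f' i)) \<le> (\<Sum>i\<in>I. b (T (f i)) (f i))"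
    if "orthonormal I f'" for f' using max[OF that] by simp
  have le: "enat (card {i\<in>I. \<tau> i = \<sigma>}) \<le> linear_dim (eigenspace \<sigma>)" for \<sigma>
    using I f(1) ev by (intro orthonormal_card_le_linear_dim[of _ f]) (auto intro: orthonormal_subset)
  moreover have "linear_dim (eigenspace \<sigma>) \<le> enat (card {i\<in>I. \<tau> i = \<sigma>})"
    if i: "i \<in> I" "\<tau> i < \<sigma>" for i \<sigma>
  proof -
    define J where "J = {i\<in>I. \<tau> i = \<sigma>}"
    have J: "finite J" "J \<subseteq> I" "orthonormal J f"
      using I f(1) unfolding J_def by (auto intro: orthonormal_subset)
    have "eigenspace \<sigma> \<subseteq> span (f ` J)"
    proof
      fix e assume e: "e \<in> eigenspace \<sigma>"
      define h where "h = e - proj J f e"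
      have "proj J f e \<in> eigenspace \<sigma>"
        using ev unfolding proj_def J_def
        by (intro subspace_sum subspace_mul subspace_eigenspace) auto
      then have h: "h \<in> eigenspace \<sigma>"
        unfolding h_def using e by (intro subspace_diff subspace_eigenspace)
      have "b h (f j) = 0" if "j \<in> I" for j
      proof (cases "j \<in> J")
        case True
        then show ?thesis unfolding h_def by (rule residual_orthogonal[OF J(1,3)])
      next
        case False
        with h ev[OF that] that show ?thesis
          unfolding J_def eigenspace_def by (auto intro: eigenvectors_orthogonal)
      qed
      then have "b (T h) h \<le> \<tau> i * b h h"
        using trace_maximizer_swap[OF I f(1) maxf i(1), of h] q[OF i(1)] by simp
      moreover have "b (T h) h = \<sigma> * b h h" using h by (simp add: eigenspace_def scaleR_left)
      ultimately have "b h h \<le> 0" using i(2) self_nonneg[of h] by (simp add: mult_le_cancel_right)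
      then have "h = 0" using self_pos[of h] by fastforce
      then show "e \<in> span (f ` J)" using proj_in_span[of J f e] by (simp add: h_def)
    qed
    then have "linear_dim (eigenspace \<sigma>) \<le> enat (card (f ` J))"
      using J(1) by (intro linear_dim_le_card) auto
    also have "\<dots> \<le> enat (card J)" using J(1) by (simp add: card_image_le)
    finally show ?thesis unfolding J_def .
  qed
  ultimately have "largest_eigenvalues I \<tau>" unfolding largest_eigenvalues_def by (blast intro: antisym)
  then show ?thesis by blast
qed

end

section \<open>Parseval and Hilbert--Schmidt operators\<close>

lemma orthonormal_basis_orthonormal:
  "orthonormal_basis B \<Longrightarrow> F \<subseteq> B \<Longrightarrow> inner.orthonormal F (\<lambda>x. x)"
  unfolding orthonormal_basis_def inner.orthonormal_def pairwise_def orthogonal_def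
  by (metis norm_eq_1 subsetD)

text \<open>Density gives \<open>y\<close> near \<open>x\<close> in the span of a finite
  \<open>F\<close>. For every finite \<open>G\<close> containing \<open>F\<close>, the projection
  onto the span of \<open>G\<close> is at least as near to \<open>x\<close>, which is convergence
  along the net of finite subsets.\<close>

theorem parseval:
  fixes x :: "'h::{real_inner,complete_space}"
  assumes B: "orthonormal_basis B"
  shows "((\<lambda>\<beta>. (x \<bullet> \<beta>)\<^sup>2) has_sum (x \<bullet> x)) B"
  unfolding has_sum_def
proof (rule tendstoI)
  fix e :: real assume "e > 0"
  have "x \<in> closure (span B)" using B by (simp add: orthonormal_basis_def)
  then obtain y where y: "y \<in> span B" "dist y x < sqrt e"
    using \<open>e > 0\<close> unfolding closure_approachable by (metis real_sqrt_gt_zero)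
  then obtain F where F: "finite F" "F \<subseteq> B" "y \<in> span F"
    unfolding span_explicit[of B] by (auto intro: span_sum span_mul span_base)
  have "dist (\<Sum>\<beta>\<in>G. (x \<bullet> \<beta>)\<^sup>2) (x \<bullet> x) < e" if G: "finite G" "F \<subseteq> G" "G \<subseteq> B" for G
  proof -
    define r where "r = x - inner.proj G (\<lambda>x. x) x"
    have on: "inner.orthonormal G (\<lambda>x. x)" using B G(3) by (rule orthonormal_basis_orthonormal)
    have "x \<bullet> x = (\<Sum>\<beta>\<in>G. (x \<bullet> \<beta>)\<^sup>2) + r \<bullet> r"
      unfolding r_def by (rule inner.pythagoras_proj[OF G(1) on])
    moreover have "y \<in> span ((\<lambda>x. x) ` G)" using span_mono[OF G(2)] F(3) by auto
    then have "r \<bullet> r \<le> (x - y) \<bullet> (x - y)"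
      unfolding r_def by (rule inner.proj_nearest[OF G(1) on])
    moreover have "(x - y) \<bullet> (x - y) < e"
    proof -
      have "norm (x - y) < sqrt e" using y(2) by (simp add: dist_norm norm_minus_commute)
      then have "(norm (x - y))\<^sup>2 < (sqrt e)\<^sup>2" by (intro power_strict_mono) auto
      then show ?thesis using \<open>e > 0\<close> by (simp add: power2_norm_eq_inner)
    qed
    ultimately show ?thesis by (simp add: dist_real_def)
  qed
  with F show "\<forall>\<^sub>F G in finite_subsets_at_top B. dist (\<Sum>\<beta>\<in>G. (x \<bullet> \<beta>)\<^sup>2) (x \<bullet> x) < e"
    unfolding eventually_finite_subsets_at_top by blast
qed

text \<open>The combinations lie in a Minkowski sum of segments. The compact set will hold all
  truncations of a Hilbert-Schmidt image to finitely many coordinates.\<close>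

lemma compact_box_combinations:
  fixes F :: "'h::real_normed_vector set"
  assumes "finite F"
  shows "\<exists>C. compact C \<and> (\<forall>c. (\<forall>\<beta>\<in>F. \<bar>c \<beta>\<bar> \<le> R) \<longrightarrow> (\<Sum>\<beta>\<in>F. c \<beta> *\<^sub>R \<beta>) \<in> C)"
  using assms
proof (induction F rule: finite_induct)
  case empty
  show ?case by (intro exI[of _ "{0}"]) simp
next
  case (insert \<beta> F)
  then obtain C where C: "compact C" "\<And>c. (\<forall>\<beta>\<in>F. \<bar>c \<beta>\<bar> \<le> R) \<Longrightarrow> (\<Sum>\<beta>\<in>F. c \<beta> *\<^sub>R \<beta>) \<in> C" by blast
  define L where "L = (\<lambda>s. s *\<^sub>R \<beta>) ` {-R..R}"
  have "compact L" unfolding L_def by (intro compact_continuous_image continuous_intros compact_Icc)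
  then have "compact {x + y |x y. x \<in> L \<and> y \<in> C}" using C(1) by (rule compact_sums)
  moreover have "(\<Sum>\<beta>\<in>insert \<beta> F. c \<beta> *\<^sub>R \<beta>) \<in> {x + y |x y. x \<in> L \<and> y \<in> C}"
    if "\<forall>\<beta>\<in>insert \<beta> F. \<bar>c \<beta>\<bar> \<le> R" for c
  proof -
    have "c \<beta> *\<^sub>R \<beta> \<in> L" unfolding L_def using that by (intro imageI) (auto simp: abs_le_iff)
    moreover have "(\<Sum>\<beta>\<in>F. c \<beta> *\<^sub>R \<beta>) \<in> C" using that by (intro C(2)) auto
    ultimately show ?thesis using insert(1,2) by auto
  qed
  ultimately show ?case by blast
qed

lemma compact_closureI:
  fixes A :: "'h::{real_normed_vector,complete_space} set"
  assumes "\<And>e. e > 0 \<Longrightarrow> \<exists>C. compact C \<and> (\<forall>x\<in>A. \<exists>y\<in>C. dist x y < e)"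
  shows "compact (closure A)"
  unfolding compact_eq_totally_bounded complete_eq_closed
proof (intro conjI allI impI)
  show "closed (closure A)" by simp
  fix e :: real assume "e > 0"
  then obtain C where C: "compact C" "\<And>x. x \<in> A \<Longrightarrow> \<exists>y\<in>C. dist x y < e / 3"
    using assms[of "e / 3"] by auto
  obtain k where k: "finite k" "C \<subseteq> (\<Union>x\<in>k. ball x (e / 3))"
    using C(1) \<open>e > 0\<close> unfolding compact_eq_totally_bounded by (metis divide_pos_pos zero_less_numeral)
  \<comment> \<open>Closed balls make the finite union closed, so it absorbs the closure; the radius
    \<open>2 * e / 3\<close> stays below \<open>e\<close>.\<close>
  have "A \<subseteq> (\<Union>x\<in>k. cball x (2 * e / 3))"
  proof
    fix a assume "a \<in> A"
    then obtain y where y: "y \<in> C" "dist a y < e / 3" using C(2) by blast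
    then obtain x where "x \<in> k" "dist x y < e / 3" using k(2) by auto
    then show "a \<in> (\<Union>x\<in>k. cball x (2 * e / 3))"
      using y(2) dist_triangle2[of x a y] by force
  qed
  then have "closure A \<subseteq> (\<Union>x\<in>k. cball x (2 * e / 3))"
    using k(1) by (intro closure_minimal closed_UN) auto
  also have "\<dots> \<subseteq> (\<Union>x\<in>k. ball x e)" using \<open>e > 0\<close> by force
  finally show "\<exists>k. finite k \<and> closure A \<subseteq> (\<Union>x\<in>k. ball x e)" using k(1) by blast
qed

text \<open>The majorant \<open>a\<close> is uniform over the unit ball, so one finite
  \<open>F\<close> makes all tails small at once; the remaining finitely many coefficients are
  bounded and fill a compact box.\<close>

theorem hilbert_schmidt_compact:
  fixes T :: "'f::real_normed_vector \<Rightarrow> 'h::{real_inner,complete_space}"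
  assumes B: "orthonormal_basis B" and a: "a summable_on B"
    and bound: "\<And>f \<beta>. norm f \<le> 1 \<Longrightarrow> \<beta> \<in> B \<Longrightarrow> (T f \<bullet> \<beta>)\<^sup>2 \<le> a \<beta>"
  shows "compact (closure (T ` cball 0 1))"
proof (rule compact_closureI)
  fix e :: real assume "e > 0"
  have a0: "0 \<le> a \<beta>" if "\<beta> \<in> B" for \<beta>
    using bound[of 0 \<beta>] that by (simp add: order_trans[OF zero_le_power2])
  obtain F where F: "finite F" "F \<subseteq> B" "dist (sum a F) (infsum a B) \<le> e\<^sup>2 / 2"
    using infsum_finite_approximation[OF a, of "e\<^sup>2 / 2"] \<open>e > 0\<close> by auto
  have on: "inner.orthonormal F (\<lambda>x. x)" using B F(2) by (rule orthonormal_basis_orthonormal)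
  obtain C where C: "compact C"
    "\<And>c. (\<forall>\<beta>\<in>F. \<bar>c \<beta>\<bar> \<le> sqrt (infsum a B)) \<Longrightarrow> (\<Sum>\<beta>\<in>F. c \<beta> *\<^sub>R \<beta>) \<in> C"
    using compact_box_combinations[OF F(1), of "sqrt (infsum a B)"] by blast
  have "inner.proj F (\<lambda>x. x) (T f) \<in> C \<and> dist (T f) (inner.proj F (\<lambda>x. x) (T f)) < e"
    if f: "norm f \<le> 1" for f
  proof
    have "\<bar>T f \<bullet> \<beta>\<bar> \<le> sqrt (infsum a B)" if "\<beta> \<in> F" for \<beta>
    proof -
      have "\<beta> \<in> B" using that F(2) by blast
      then have "(T f \<bullet> \<beta>)\<^sup>2 \<le> a \<beta>" using f by (intro bound)
      also have "a \<beta> \<le> infsum a B"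
        using finite_sum_le_infsum[OF a, of "{\<beta>}"] \<open>\<beta> \<in> B\<close> a0 by simp
      finally show ?thesis using real_le_rsqrt real_sqrt_abs real_sqrt_le_iff by metis
    qed
    then show "inner.proj F (\<lambda>x. x) (T f) \<in> C"
      unfolding inner.proj_def by (intro C(2)) blast
    define r where "r = T f - inner.proj F (\<lambda>x. x) (T f)"
    have "T f \<bullet> T f \<le> (\<Sum>\<beta>\<in>F. (T f \<bullet> \<beta>)\<^sup>2) + (infsum a B - sum a F)"
    proof (rule has_sum_le_finite_sums[OF parseval[OF B]])
      fix G assume G: "finite G" "G \<subseteq> B"
      have "(\<Sum>\<beta>\<in>G. (T f \<bullet> \<beta>)\<^sup>2) \<le> (\<Sum>\<beta>\<in>F \<union> G. (T f \<bullet> \<beta>)\<^sup>2)"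
        using F(1) G(1) by (intro sum_mono2) auto
      also have "\<dots> = (\<Sum>\<beta>\<in>F. (T f \<bullet> \<beta>)\<^sup>2) + (\<Sum>\<beta>\<in>G - F. (T f \<bullet> \<beta>)\<^sup>2)"
        using F(1) G(1) sum.union_disjoint[of F "G - F"] by simp
      also have "(\<Sum>\<beta>\<in>G - F. (T f \<bullet> \<beta>)\<^sup>2) \<le> sum a (G - F)"
        using f G(2) by (intro sum_mono bound) auto
      also have "sum a (G - F) = sum a (F \<union> G) - sum a F"
        using F(1) G(1) by (simp add: sum_diff[symmetric] Un_Diff)
      also have "sum a (F \<union> G) \<le> infsum a B"
        using F(1,2) G a0 by (intro finite_sum_le_infsum a) auto
      finally show "(\<Sum>\<beta>\<in>G. (T f \<bullet> \<beta>)\<^sup>2) \<le> (\<Sum>\<beta>\<in>F. (T f \<bullet> \<beta>)\<^sup>2) + (infsum a B - sum a F)"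
        by simp
    qed
    then have "r \<bullet> r \<le> infsum a B - sum a F"
      using inner.pythagoras_proj[OF F(1) on, of "T f"] unfolding r_def by simp
    also have "\<dots> \<le> e\<^sup>2 / 2" using F(3) unfolding dist_real_def by linarith
    also have "\<dots> < e\<^sup>2" using \<open>e > 0\<close> by simp
    finally have "(norm r)\<^sup>2 < e\<^sup>2" by (simp add: power2_norm_eq_inner)
    then show "dist (T f) (inner.proj F (\<lambda>x. x) (T f)) < e"
      using \<open>e > 0\<close> unfolding r_def dist_norm by (simp add: power_less_imp_less_base)
  qed
  then have "\<forall>x\<in>T ` cball 0 1. \<exists>y\<in>C. dist x y < e" by (metis imageE mem_cball_0)
  with C(1) show "\<exists>C. compact C \<and> (\<forall>x\<in>T ` cball 0 1. \<exists>y\<in>C. dist x y < e)" by blast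
qed

section \<open>Covariance operators\<close>

lemma (in prob_space) covariance_eq:
  fixes Z W :: "'a \<Rightarrow> real"
  assumes "integrable M Z" "integrable M W" "integrable M (\<lambda>\<omega>. Z \<omega> * W \<omega>)"
  shows "covariance M Z W = expectation (\<lambda>\<omega>. Z \<omega> * W \<omega>) - expectation Z * expectation W"
proof -
  have "covariance M Z W = expectation (\<lambda>\<omega>. Z \<omega> * W \<omega> - expectation Z * W \<omega>
      - expectation W * Z \<omega> + expectation Z * expectation W)"
    unfolding covariance_def by (intro Bochner_Integration.integral_cong) (auto simp: algebra_simps)
  also have "\<dots> = expectation (\<lambda>\<omega>. Z \<omega> * W \<omega>) - expectation Z * expectation W"
    using assms by (simp add: prob_space)
  finally show ?thesis .
qed

lemma covariance_commute: "covariance M Z W = covariance M W Z"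
  unfolding covariance_def by (simp add: mult.commute)

lemma covariance_cong:
  assumes "\<And>\<omega>. \<omega> \<in> space M \<Longrightarrow> Z \<omega> = Z' \<omega>" "\<And>\<omega>. \<omega> \<in> space M \<Longrightarrow> W \<omega> = W' \<omega>"
  shows "covariance M Z W = covariance M Z' W'"
proof -
  have "integral\<^sup>L M Z = integral\<^sup>L M Z'" "integral\<^sup>L M W = integral\<^sup>L M W'"
    using assms by (auto intro: Bochner_Integration.integral_cong)
  then show ?thesis
    unfolding covariance_def using assms by (auto intro!: Bochner_Integration.integral_cong)
qed

section \<open>Elements of a reproducing kernel space as bounded random variables\<close>

locale rkhs_variable = prob_space M
  for M :: "'w measure" +
  fixes N :: "'a measure" and U :: "'w \<Rightarrow> 'a" and k :: "'a \<Rightarrow> 'a \<Rightarrow> real"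
    and ev :: "'h::{real_inner,complete_space} \<Rightarrow> 'a \<Rightarrow> real"
  assumes U: "U \<in> M \<rightarrow>\<^sub>M N" and rkhs: "rkhs (space N) k ev" and adm: "admissible_kernel M N U k"
begin

lemma evaluation_representer:
  assumes "x \<in> space N"
  obtains kx where "\<And>f. ev f x = f \<bullet> kx" "\<And>y. y \<in> space N \<Longrightarrow> ev kx y = k x y" "kx \<bullet> kx = k x x"
proof -
  obtain kx where kx: "\<And>f. ev f x = f \<bullet> kx" "\<And>y. y \<in> space N \<Longrightarrow> ev kx y = k x y"
    using rkhs assms unfolding rkhs_def by blast
  moreover have "kx \<bullet> kx = k x x" using kx assms by metis
  ultimately show thesis using that by blast
qed

lemma ev_add: "x \<in> space N \<Longrightarrow> ev (f + g) x = ev f x + ev g x"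
  by (elim evaluation_representer) (simp add: inner_add_left)

lemma ev_scaleR: "x \<in> space N \<Longrightarrow> ev (c *\<^sub>R f) x = c * ev f x"
  by (elim evaluation_representer) simp

lemma ev_tendsto: "x \<in> space N \<Longrightarrow> f \<longlonglongrightarrow> g \<Longrightarrow> (\<lambda>n. ev (f n) x) \<longlonglongrightarrow> ev g x"
  by (elim evaluation_representer) (simp add: tendsto_inner)

text \<open>Evaluation at \<open>x\<close> is the inner product with a representer of squared norm
  \<open>k x x\<close>, so Cauchy--Schwarz and the bounded kernel give a bound uniform in
  \<open>x\<close>.\<close>

lemma ev_bounded: "\<exists>C\<ge>0. \<forall>f. \<forall>x\<in>space N. \<bar>ev f x\<bar> \<le> C * norm f"
proof -
  obtain K where "\<forall>z\<in>(\<lambda>(x, y). k x y) ` (space N \<times> space N). norm z \<le> K"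
    using adm unfolding admissible_kernel_def bounded_iff by blast
  then have K: "k x x \<le> K" if "x \<in> space N" for x using that by force
  have "\<bar>ev f x\<bar> \<le> sqrt \<bar>K\<bar> * norm f" if x: "x \<in> space N" for f x
  proof -
    obtain kx where kx: "\<And>f. ev f x = f \<bullet> kx" "kx \<bullet> kx = k x x"
      using evaluation_representer[OF x] by metis
    have "norm kx \<le> sqrt \<bar>K\<bar>" unfolding norm_eq_sqrt_inner kx(2) using K[OF x] by simp
    then show ?thesis
      using Cauchy_Schwarz_ineq2[of f kx] mult_left_mono[of "norm kx" "sqrt \<bar>K\<bar>" "norm f"]
      by (simp add: kx(1) mult.commute)
  qed
  then show ?thesis by (intro exI[of _ "sqrt \<bar>K\<bar>"]) simp
qed

text \<open>The functions with measurable representative form a closed subspace containing all kernel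
  sections, and only \<open>0\<close> is orthogonal to all kernel sections.\<close>

lemma ev_measurable: "ev f \<in> borel_measurable N"
proof -
  define W where "W = {f. ev f \<in> borel_measurable N}"
  \<comment> \<open>Measurability depends only on the values on \<open>space N\<close>, and only
    there are representers known to agree with kernel sections.\<close>
  have W_I: "f \<in> W" if "g \<in> borel_measurable N" "\<And>x. x \<in> space N \<Longrightarrow> ev f x = g x" for f g
    unfolding W_def using that measurable_cong[of N "ev f" g borel] by blast
  have kernel: "kx \<in> W" if "x \<in> space N" "\<And>y. y \<in> space N \<Longrightarrow> ev kx y = k x y" for x kx
  proof -
    have "(\<lambda>(x, y). k x y) \<in> borel_measurable (N \<Otimes>\<^sub>M N)"
      using adm unfolding admissible_kernel_def by blast
    from measurable_compose[OF measurable_Pair1'[OF that(1)] this]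
    have "(\<lambda>y. k x y) \<in> borel_measurable N" by simp
    then show ?thesis using that(2) by (rule W_I)
  qed
  have "subspace W"
  proof (rule subspaceI)
    show "x + y \<in> W" if "x \<in> W" "y \<in> W" for x y
    proof (rule W_I)
      show "(\<lambda>t. ev x t + ev y t) \<in> borel_measurable N" using that unfolding W_def by simp
    qed (rule ev_add)
    show "c *\<^sub>R x \<in> W" if "x \<in> W" for c x
    proof (rule W_I)
      show "(\<lambda>t. c * ev x t) \<in> borel_measurable N" using that unfolding W_def by simp
    qed (rule ev_scaleR)
    show "0 \<in> W"
    proof (rule W_I)
      show "ev 0 t = 0" if "t \<in> space N" for t using ev_scaleR[OF that, of 0 0] by simp
    qed simp
  qed
  moreover have "closed W"
    unfolding closed_sequential_limits
  proof (intro allI impI, elim conjE)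
    fix g l assume g: "\<forall>n. g n \<in> W" "g \<longlonglongrightarrow> l"
    have "ev l \<in> borel_measurable N"
    proof (rule borel_measurable_LIMSEQ_metric)
      show "ev (g n) \<in> borel_measurable N" for n using g(1) by (simp add: W_def)
      show "(\<lambda>n. ev (g n) x) \<longlonglongrightarrow> ev l x" if "x \<in> space N" for x
        using that g(2) by (rule ev_tendsto)
    qed
    then show "l \<in> W" by (simp add: W_def)
  qed
  ultimately have "\<exists>u\<in>W. \<forall>h\<in>W. (f - u) \<bullet> h = 0" by (rule inner.projection_exists)
  then obtain u where u: "u \<in> W" "\<And>h. h \<in> W \<Longrightarrow> (f - u) \<bullet> h = 0" by blast
  have "ev f x = ev u x" if x: "x \<in> space N" for x
  proof -
    obtain kx where kx: "\<And>f. ev f x = f \<bullet> kx" "\<And>y. y \<in> space N \<Longrightarrow> ev kx y = k x y"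
      using evaluation_representer[OF x] by metis
    then show ?thesis using u(2)[OF kernel[OF x kx(2)]] by (simp add: inner_diff_left)
  qed
  moreover have "ev u \<in> borel_measurable N" using u(1) by (simp add: W_def)
  ultimately have "f \<in> W" using W_I by blast
  then show ?thesis by (simp add: W_def)
qed

abbreviation rv :: "'h \<Rightarrow> 'w \<Rightarrow> real" where
  "rv f \<equiv> \<lambda>\<omega>. ev f (U \<omega>)"

lemma rv_measurable [measurable]: "rv f \<in> borel_measurable M"
  using measurable_compose[OF U ev_measurable] .

lemma U_space: "\<omega> \<in> space M \<Longrightarrow> U \<omega> \<in> space N"
  using U by (rule measurable_space)

lemma rv_bounded: "\<exists>C\<ge>0. \<forall>f. \<forall>\<omega>\<in>space M. \<bar>rv f \<omega>\<bar> \<le> C * norm f"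
  using ev_bounded U_space by blast

lemma rv_integrable: "integrable M (rv f)"
proof -
  obtain C where "\<And>f \<omega>. \<omega> \<in> space M \<Longrightarrow> \<bar>rv f \<omega>\<bar> \<le> C * norm f" using rv_bounded by blast
  then show ?thesis by (intro integrable_const_bound[of _ "C * norm f"]) auto
qed

lemma rv_square_integrable: "integrable M (\<lambda>\<omega>. (rv f \<omega>)\<^sup>2)"
proof -
  obtain C where C: "\<And>f \<omega>. \<omega> \<in> space M \<Longrightarrow> \<bar>rv f \<omega>\<bar> \<le> C * norm f" using rv_bounded by blast
  have "(rv f \<omega>)\<^sup>2 \<le> (C * norm f)\<^sup>2" if "\<omega> \<in> space M" for \<omega>
    using power_mono[OF C[OF that, of f], of 2] by simp
  then show ?thesis by (intro integrable_const_bound[of _ "(C * norm f)\<^sup>2"]) auto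
qed

lemma centered_bounded:
  "\<exists>C\<ge>0. \<forall>f. \<forall>\<omega>\<in>space M. \<bar>rv f \<omega> - expectation (rv f)\<bar> \<le> C * norm f"
proof -
  obtain C where C: "C \<ge> 0" "\<And>f \<omega>. \<omega> \<in> space M \<Longrightarrow> \<bar>rv f \<omega>\<bar> \<le> C * norm f" using rv_bounded by blast
  have E: "\<bar>expectation (rv f)\<bar> \<le> C * norm f" for f
  proof -
    have "\<bar>expectation (rv f)\<bar> \<le> expectation (\<lambda>\<omega>. \<bar>rv f \<omega>\<bar>)" by (rule integral_abs_bound)
    also have "\<dots> \<le> C * norm f"
      using C(2) rv_integrable by (intro integral_le_const) auto
    finally show ?thesis .
  qed
  have "\<bar>rv f \<omega> - expectation (rv f)\<bar> \<le> 2 * C * norm f" if "\<omega> \<in> space M" for f \<omega>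
    using order_trans[OF abs_triangle_ineq4 add_mono[OF C(2)[OF that, of f] E[of f]]] by simp
  with C(1) show ?thesis by (intro exI[of _ "2 * C"]) simp
qed

text \<open>The values of the basis functions at \<open>U \<omega>\<close> are the coefficients of
  the representer of evaluation there, so Bessel bounds the sum of their squares by
  \<open>k (U \<omega>) (U \<omega>)\<close> pointwise.\<close>

lemma summable_second_moments:
  assumes B: "orthonormal_basis B"
  shows "(\<lambda>\<beta>. expectation (\<lambda>\<omega>. (rv \<beta> \<omega>)\<^sup>2)) summable_on B"
proof (rule nonneg_bdd_above_summable_on)
  show "bdd_above (sum (\<lambda>\<beta>. expectation (\<lambda>\<omega>. (rv \<beta> \<omega>)\<^sup>2)) ` {F. F \<subseteq> B \<and> finite F})"
  proof (rule bdd_aboveI2)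
    fix F assume "F \<in> {F. F \<subseteq> B \<and> finite F}"
    then have F: "finite F" "F \<subseteq> B" by auto
    note int = rv_square_integrable
    have "(\<Sum>\<beta>\<in>F. expectation (\<lambda>\<omega>. (rv \<beta> \<omega>)\<^sup>2)) = expectation (\<lambda>\<omega>. \<Sum>\<beta>\<in>F. (rv \<beta> \<omega>)\<^sup>2)"
      using int by (simp add: Bochner_Integration.integral_sum)
    also have "\<dots> \<le> expectation (\<lambda>\<omega>. k (U \<omega>) (U \<omega>))"
    proof (rule integral_mono)
      show "integrable M (\<lambda>\<omega>. k (U \<omega>) (U \<omega>))" using adm unfolding admissible_kernel_def by blast
      fix \<omega> assume "\<omega> \<in> space M"
      then obtain kx where kx: "\<And>f. rv f \<omega> = f \<bullet> kx" "kx \<bullet> kx = k (U \<omega>) (U \<omega>)"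
        using evaluation_representer[OF U_space] by metis
      then show "(\<Sum>\<beta>\<in>F. (rv \<beta> \<omega>)\<^sup>2) \<le> k (U \<omega>) (U \<omega>)"
        using inner.bessel[OF F(1) orthonormal_basis_orthonormal[OF B F(2)], of kx]
        by (simp add: inner_commute)
    qed (use int in auto)
    finally show "(\<Sum>\<beta>\<in>F. expectation (\<lambda>\<omega>. (rv \<beta> \<omega>)\<^sup>2)) \<le> expectation (\<lambda>\<omega>. k (U \<omega>) (U \<omega>))" .
  qed
qed simp

end

section \<open>The covariance form of a pair of variables and its operator\<close>

locale rkhs_pair = X: rkhs_variable M NX X kX evX + Y: rkhs_variable M NY Y kY evY
  for M :: "'w measure"
    and NX :: "'x measure" and X kX and evX :: "'f::{real_inner,complete_space} \<Rightarrow> 'x \<Rightarrow> real"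
    and NY :: "'y measure" and Y kY and evY :: "'g::{real_inner,complete_space} \<Rightarrow> 'y \<Rightarrow> real"
begin

abbreviation cov :: "'f \<Rightarrow> 'g \<Rightarrow> real" where
  "cov f g \<equiv> covariance M (X.rv f) (Y.rv g)"

lemma integrable_product: "integrable M (\<lambda>\<omega>. X.rv f \<omega> * Y.rv g \<omega>)"
proof -
  obtain C where C: "C \<ge> 0" "\<And>f \<omega>. \<omega> \<in> space M \<Longrightarrow> \<bar>X.rv f \<omega>\<bar> \<le> C * norm f"
    using X.rv_bounded by blast
  obtain D where D: "\<And>f \<omega>. \<omega> \<in> space M \<Longrightarrow> \<bar>Y.rv f \<omega>\<bar> \<le> D * norm f"
    using Y.rv_bounded by blast
  have "\<bar>X.rv f \<omega> * Y.rv g \<omega>\<bar> \<le> (C * norm f) * (D * norm g)" if "\<omega> \<in> space M" for \<omega>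
    unfolding abs_mult using C(1) by (intro mult_mono C(2) D that) auto
  then show ?thesis by (intro X.integrable_const_bound[of _ "(C * norm f) * (D * norm g)"]) auto
qed

lemma cov_eq: "cov f g = X.expectation (\<lambda>\<omega>. X.rv f \<omega> * Y.rv g \<omega>) - X.expectation (X.rv f) * X.expectation (Y.rv g)"
  by (intro X.covariance_eq X.rv_integrable Y.rv_integrable integrable_product)

text \<open>Evaluation is known to be linear only at points of \<open>space N\<close>, so each
  algebraic identity is first transferred to the variables on \<open>space M\<close>.\<close>

lemma bounded_bilinear_cov: "bounded_bilinear cov"
proof
  show "cov (f + f') g = cov f g + cov f' g" for f f' g
  proof -
    have "cov (f + f') g = covariance M (\<lambda>\<omega>. X.rv f \<omega> + X.rv f' \<omega>) (Y.rv g)"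
      by (intro covariance_cong) (auto simp: X.ev_add X.U_space)
    also have "\<dots> = cov f g + cov f' g"
      unfolding cov_eq
      by (subst X.covariance_eq)
        (simp_all add: X.rv_integrable Y.rv_integrable integrable_product distrib_right)
    finally show ?thesis .
  qed
  show "cov f (g + g') = cov f g + cov f g'" for f g g'
  proof -
    have "cov f (g + g') = covariance M (X.rv f) (\<lambda>\<omega>. Y.rv g \<omega> + Y.rv g' \<omega>)"
      by (intro covariance_cong) (auto simp: Y.ev_add Y.U_space)
    also have "\<dots> = cov f g + cov f g'"
      unfolding cov_eq
      by (subst X.covariance_eq)
        (simp_all add: X.rv_integrable Y.rv_integrable integrable_product distrib_left)
    finally show ?thesis .
  qed
  show "cov (r *\<^sub>R f) g = r *\<^sub>R cov f g" for r f g
  proof -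
    have "cov (r *\<^sub>R f) g = covariance M (\<lambda>\<omega>. r * X.rv f \<omega>) (Y.rv g)"
      by (intro covariance_cong) (auto simp: X.ev_scaleR X.U_space)
    also have "\<dots> = r *\<^sub>R cov f g"
      unfolding cov_eq
      by (subst X.covariance_eq)
        (simp_all add: X.rv_integrable Y.rv_integrable integrable_product mult.assoc right_diff_distrib)
    finally show ?thesis .
  qed
  show "cov f (r *\<^sub>R g) = r *\<^sub>R cov f g" for r f g
  proof -
    have "cov f (r *\<^sub>R g) = covariance M (X.rv f) (\<lambda>\<omega>. r * Y.rv g \<omega>)"
      by (intro covariance_cong) (auto simp: Y.ev_scaleR Y.U_space)
    also have "\<dots> = r *\<^sub>R cov f g"
      unfolding cov_eq
      by (subst X.covariance_eq)
        (simp_all add: X.rv_integrable Y.rv_integrable integrable_product mult.left_commute right_diff_distrib)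
    finally show ?thesis .
  qed
  obtain C where C: "C \<ge> 0"
    "\<And>f \<omega>. \<omega> \<in> space M \<Longrightarrow> \<bar>X.rv f \<omega> - X.expectation (X.rv f)\<bar> \<le> C * norm f"
    using X.centered_bounded by blast
  obtain D where D: "D \<ge> 0"
    "\<And>f \<omega>. \<omega> \<in> space M \<Longrightarrow> \<bar>Y.rv f \<omega> - X.expectation (Y.rv f)\<bar> \<le> D * norm f"
    using Y.centered_bounded by blast
  have "norm (cov f g) \<le> norm f * norm g * (C * D)" for f g
  proof -
    have le: "\<bar>(X.rv f \<omega> - X.expectation (X.rv f)) * (Y.rv g \<omega> - X.expectation (Y.rv g))\<bar>
        \<le> (C * norm f) * (D * norm g)" if "\<omega> \<in> space M" for \<omega>
      unfolding abs_mult using C(1) by (intro mult_mono C(2) D(2) that) auto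
    have int: "integrable M (\<lambda>\<omega>. (X.rv f \<omega> - X.expectation (X.rv f)) * (Y.rv g \<omega> - X.expectation (Y.rv g)))"
      using le by (intro X.integrable_const_bound[of _ "(C * norm f) * (D * norm g)"]) auto
    have "\<bar>cov f g\<bar> \<le> X.expectation (\<lambda>\<omega>. \<bar>(X.rv f \<omega> - X.expectation (X.rv f)) * (Y.rv g \<omega> - X.expectation (Y.rv g))\<bar>)"
      unfolding covariance_def by (rule integral_abs_bound)
    also have "\<dots> \<le> (C * norm f) * (D * norm g)"
      using le int by (intro X.integral_le_const) auto
    finally show ?thesis by (simp add: algebra_simps)
  qed
  then show "\<exists>K. \<forall>f g. norm (cov f g) \<le> norm f * norm g * K" by blast
qed

abbreviation Sig :: "'f \<Rightarrow> 'g" where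
  "Sig \<equiv> cov_operator M evX X evY Y"

text \<open>The definite description is justified: Lax--Milgram for \<open>inner\<close> yields an
  operator, and testing against all \<open>g\<close> determines it.\<close>

lemma Sig_inner: "Sig f \<bullet> g = cov f g"
proof -
  obtain T where T: "\<And>f g. T f \<bullet> g = cov f g"
    using inner.operator_of_bilinear_form[OF bounded_bilinear_cov] by blast
  have "T' = T" if "\<forall>f g. cov f g = T' f \<bullet> g" for T'
    using that T by (intro ext) (metis vector_eq_rdot)
  then have "Sig = T"
    unfolding cov_operator_def using T by (intro the_equality) auto
  then show ?thesis by (simp add: T)
qed

lemma bounded_linear_Sig: "bounded_linear Sig"
  using inner.bounded_linear_of_bilinear_form[OF bounded_bilinear_cov Sig_inner] .

lemma bounded_bilinear_inner_Sig: "bounded_bilinear (\<lambda>u f. u \<bullet> Sig f)"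
  using bounded_bilinear.comp[OF bounded_bilinear_inner bounded_linear_ident bounded_linear_Sig] .

text \<open>As \<open>adjoint\<close> is defined by choice, some adjoint has to exist before its
  property can be used; Lax--Milgram provides one.\<close>

lemma adjoint_Sig_inner: "adjoint Sig u \<bullet> f = u \<bullet> Sig f"
proof -
  obtain T where "\<And>u f. T u \<bullet> f = u \<bullet> Sig f"
    using inner.operator_of_bilinear_form[OF bounded_bilinear_inner_Sig] by blast
  then have "\<forall>x y. Sig x \<bullet> y = x \<bullet> T y" by (metis inner_commute)
  then have "\<forall>x y. Sig x \<bullet> y = x \<bullet> adjoint Sig y" 
    unfolding adjoint_def by (rule someI[where P="\<lambda>T. \<forall>x y. Sig x \<bullet> y = x \<bullet> T y"])
  then show ?thesis by (metis inner_commute)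
qed

lemma bounded_linear_adjoint_Sig: "bounded_linear (adjoint Sig)"
  using inner.bounded_linear_of_bilinear_form[OF bounded_bilinear_inner_Sig adjoint_Sig_inner] .

text \<open>The centered variable of \<open>f\<close> is bounded uniformly over the unit ball. What
  remains is a multiple of the second moment of \<open>g\<close>, which is summable over a
  basis.\<close>

lemma cov_square_le:
  "\<exists>C. \<forall>f g. norm f \<le> 1 \<longrightarrow> (cov f g)\<^sup>2 \<le> C * X.expectation (\<lambda>\<omega>. (Y.rv g \<omega>)\<^sup>2)"
proof -
  obtain C where C: "C \<ge> 0"
    "\<And>f \<omega>. \<omega> \<in> space M \<Longrightarrow> \<bar>X.rv f \<omega> - X.expectation (X.rv f)\<bar> \<le> C * norm f"
    using X.centered_bounded by blast
  have "(cov f g)\<^sup>2 \<le> C\<^sup>2 * X.expectation (\<lambda>\<omega>. (Y.rv g \<omega>)\<^sup>2)" if f: "norm f \<le> 1" for f g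
  proof -
    define Z where "Z \<omega> = X.rv f \<omega> - X.expectation (X.rv f)" for \<omega>
    define V where "V \<omega> = Y.rv g \<omega> - X.expectation (Y.rv g)" for \<omega>
    obtain D where D: "D \<ge> 0" "\<And>\<omega>. \<omega> \<in> space M \<Longrightarrow> \<bar>V \<omega>\<bar> \<le> D * norm g"
      using Y.centered_bounded unfolding V_def by blast
    have [measurable]: "Z \<in> borel_measurable M" "V \<in> borel_measurable M"
      unfolding Z_def V_def by simp_all
    have Z: "\<bar>Z \<omega>\<bar> \<le> C" if "\<omega> \<in> space M" for \<omega>
      using order_trans[OF C(2)[OF that, of f] mult_left_mono[OF f C(1)]] by (simp add: Z_def)
    have ZV: "\<bar>Z \<omega> * V \<omega>\<bar> \<le> C * (D * norm g)" if "\<omega> \<in> space M" for \<omega>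
      unfolding abs_mult using Z D C(1) that by (intro mult_mono) auto
    have V2: "(V \<omega>)\<^sup>2 \<le> (D * norm g)\<^sup>2" if "\<omega> \<in> space M" for \<omega>
      using power_mono[OF D(2)[OF that], of 2] by simp
    have ZV2: "(Z \<omega> * V \<omega>)\<^sup>2 \<le> (C * (D * norm g))\<^sup>2" if "\<omega> \<in> space M" for \<omega>
      using power_mono[OF ZV[OF that], of 2] by simp
    have int1: "integrable M (\<lambda>\<omega>. Z \<omega> * V \<omega>)"
      using ZV by (intro X.integrable_const_bound[of _ "C * (D * norm g)"]) auto
    have int2: "integrable M (\<lambda>\<omega>. (Z \<omega> * V \<omega>)\<^sup>2)"
      using ZV2 by (intro X.integrable_const_bound[of _ "(C * (D * norm g))\<^sup>2"]) auto
    have int3: "integrable M (\<lambda>\<omega>. (V \<omega>)\<^sup>2)"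
      using V2 by (intro X.integrable_const_bound[of _ "(D * norm g)\<^sup>2"]) auto
    have intY: "integrable M (\<lambda>\<omega>. (Y.rv g \<omega>)\<^sup>2)" by (rule Y.rv_square_integrable)
    have "(cov f g)\<^sup>2 = (X.expectation (\<lambda>\<omega>. Z \<omega> * V \<omega>))\<^sup>2"
      by (simp add: covariance_def Z_def V_def)
    \<comment> \<open>Nonnegativity of the variance of the product serves as Jensen's
      inequality.\<close>
    also have "\<dots> \<le> X.expectation (\<lambda>\<omega>. (Z \<omega> * V \<omega>)\<^sup>2)"
      using X.variance_eq[OF int1 int2] X.variance_positive[of "\<lambda>\<omega>. Z \<omega> * V \<omega>"] by linarith
    also have "\<dots> \<le> X.expectation (\<lambda>\<omega>. C\<^sup>2 * (V \<omega>)\<^sup>2)"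
    proof (rule integral_mono)
      fix \<omega> assume "\<omega> \<in> space M"
      then have "(Z \<omega>)\<^sup>2 \<le> C\<^sup>2" using power_mono[OF Z, of \<omega> 2] by simp
      then show "(Z \<omega> * V \<omega>)\<^sup>2 \<le> C\<^sup>2 * (V \<omega>)\<^sup>2"
        by (simp add: power_mult_distrib mult_right_mono)
    qed (use int2 int3 in auto)
    also have "\<dots> = C\<^sup>2 * X.variance (Y.rv g)" by (simp add: V_def)
    also have "\<dots> \<le> C\<^sup>2 * X.expectation (\<lambda>\<omega>. (Y.rv g \<omega>)\<^sup>2)"
      using X.variance_eq[OF Y.rv_integrable intY] by (intro mult_left_mono) auto
    finally show ?thesis .
  qed
  then show ?thesis by blast
qed

lemma compact_Sig:
  fixes B :: "'g set"
  assumes B: "orthonormal_basis B"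
  shows "compact (closure (Sig ` cball 0 1))"
proof -
  obtain C where C: "\<And>f g. norm f \<le> 1 \<Longrightarrow> (cov f g)\<^sup>2 \<le> C * X.expectation (\<lambda>\<omega>. (Y.rv g \<omega>)\<^sup>2)"
    using cov_square_le by blast
  have "(\<lambda>g. C * X.expectation (\<lambda>\<omega>. (Y.rv g \<omega>)\<^sup>2)) summable_on B"
    using Y.summable_second_moments[OF B] by (rule summable_on_cmult_right)
  with B show ?thesis by (rule hilbert_schmidt_compact) (simp add: Sig_inner C)
qed

text \<open>Parseval: the covariances are the coefficients of \<open>Sig (f j)\<close> in the
  basis.\<close>

lemma dep_eq:
  assumes "orthonormal_basis B"
  shows "dep M evX X evY Y B r f = (\<Sum>j=1..r. Sig (f j) \<bullet> Sig (f j))"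
  unfolding dep_def Sig_inner[symmetric] using infsumI[OF parseval[OF assms]] by simp

end

text \<open>A list of \<open>r\<close> largest eigenvalues need not exist, so the optimality claim
  is conditional on it. The last conjunct shows that the condition fails only when no optimizer
  exists.\<close>

theorem theorem3:
  fixes M :: "'w measure"
    and X :: "'w \<Rightarrow> 'x::euclidean_space" and Y :: "'w \<Rightarrow> 'y" and S :: "'w \<Rightarrow> 's"
    and NY :: "'y measure" and NS :: "'s measure"
    and kX :: "'x \<Rightarrow> 'x \<Rightarrow> real" and kY :: "'y \<Rightarrow> 'y \<Rightarrow> real" and kS :: "'s \<Rightarrow> 's \<Rightarrow> real"
    and evX :: "'hx::{real_inner,complete_space} \<Rightarrow> 'x \<Rightarrow> real"
    and evY :: "'hy::{real_inner,polish_space} \<Rightarrow> 'y \<Rightarrow> real"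
    and evS :: "'hs::{real_inner,polish_space} \<Rightarrow> 's \<Rightarrow> real"
    and UY :: "'hy set" and US :: "'hs set"
    and lam \<gamma> :: real and r :: nat
    and SigYX :: "'hx \<Rightarrow> 'hy" and SigSX :: "'hx \<Rightarrow> 'hs" and SigXX :: "'hx \<Rightarrow> 'hx"
    and A B :: "'hx \<Rightarrow> 'hx" and J :: "(nat \<Rightarrow> 'hx) \<Rightarrow> real"
  assumes "prob_space M"
    and "X \<in> M \<rightarrow>\<^sub>M borel" and "Y \<in> M \<rightarrow>\<^sub>M NY" and "S \<in> M \<rightarrow>\<^sub>M NS"
    and "universal_rkhs kX evX" and "rkhs (space NY) kY evY" and "rkhs (space NS) kS evS"
    and "admissible_kernel M borel X kX" and "admissible_kernel M NY Y kY"
    and "admissible_kernel M NS S kS"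
    and "countable UY" and "orthonormal_basis UY"
    and "countable US" and "orthonormal_basis US"
    and "0 \<le> lam" and "lam < 1" and "\<gamma> > 0"
    and "SigYX = cov_operator M evX X evY Y"
    and "SigSX = cov_operator M evX X evS S"
    and "SigXX = cov_operator M evX X evX X"
    and "A = (\<lambda>f. (1 - lam) *\<^sub>R adjoint SigYX (SigYX f) - lam *\<^sub>R adjoint SigSX (SigSX f))"
    and "B = (\<lambda>f. SigXX f + \<gamma> *\<^sub>R f)"
    and "J = (\<lambda>f. (1 - lam) * dep M evX X evY Y UY r f - lam * dep M evX X evS S US r f)"
  shows
    "(\<forall>\<tau>. largest_gen_eigenvalues A B r \<tau> \<longrightarrow>
        (\<exists>f\<in>feasible M evX X \<gamma> r. \<forall>i\<in>{1..r}. f i \<in> gen_eigenspace A B (\<tau> i)) \<and>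
        (\<forall>f\<in>feasible M evX X \<gamma> r. (\<forall>i\<in>{1..r}. f i \<in> gen_eigenspace A B (\<tau> i)) \<longrightarrow>
           is_arg_max J (\<lambda>g. g \<in> feasible M evX X \<gamma> r) f)) \<and>
     ((\<exists>g. is_arg_max J (\<lambda>g. g \<in> feasible M evX X \<gamma> r) g) \<longrightarrow>
        (\<exists>\<tau>. largest_gen_eigenvalues A B r \<tau>))"
proof -
  interpret PY: rkhs_pair M borel X kX evX NY Y kY evY
    using assms
    by (auto intro!: rkhs_pair.intro rkhs_variable.intro rkhs_variable_axioms.intro simp: universal_rkhs_def)
  interpret PS: rkhs_pair M borel X kX evX NS S kS evS
    using assms
    by (auto intro!: rkhs_pair.intro rkhs_variable.intro rkhs_variable_axioms.intro simp: universal_rkhs_def)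
  interpret PX: rkhs_pair M borel X kX evX borel X kX evX
    using PY.X.rkhs_variable_axioms PY.X.rkhs_variable_axioms by (rule rkhs_pair.intro)
  note A = assms(21) and B = assms(22) and J = assms(23)
  note Sig = assms(18-20)
  define b where "b f g = B f \<bullet> g" for f g
  have b_cov: "b f g = PX.cov f g + \<gamma> * (f \<bullet> g)" for f g
    by (simp add: b_def B Sig inner_add_left PX.Sig_inner)
  have "bounded_linear B"
    unfolding B Sig
    by (intro bounded_linear_add PX.bounded_linear_Sig bounded_linear_scaleR_right)
  then have "bounded_bilinear b"
    unfolding b_def using bounded_bilinear.comp[OF bounded_bilinear_inner _ bounded_linear_ident] by blast
  moreover have "b f g = b g f" for f g
    unfolding b_cov by (simp add: covariance_commute inner_commute)
  \<comment> \<open>A variance is nonnegative, so the penalty term alone gives coercivity.\<close>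
  moreover have "\<gamma> * (norm f)\<^sup>2 \<le> b f f" for f
    unfolding b_cov by (simp add: covariance_def power2_norm_eq_inner)
  ultimately have "coercive_form b \<gamma>"
    using \<open>\<gamma> > 0\<close> by (intro coercive_form.intro coercive_form_axioms.intro)
  then interpret b: coercive_form b \<gamma> .
  obtain Binv where Binv: "bounded_linear Binv" "\<And>u g. b (Binv u) g = u \<bullet> g"
    using b.operator_of_bilinear_form[OF bounded_bilinear_inner] by blast
  define T where "T f = Binv (A f)" for f
  have bT: "b (T f) g = A f \<bullet> g" for f g by (simp add: T_def Binv(2))
  have A_inner: "A f \<bullet> g = (1 - lam) * (SigYX f \<bullet> SigYX g) - lam * (SigSX f \<bullet> SigSX g)" for f g
    by (simp add: A Sig inner_diff_left PY.adjoint_Sig_inner PS.adjoint_Sig_inner)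
  define LY where "LY = closure (SigYX ` cball 0 1)"
  define LS where "LS = closure (SigSX ` cball 0 1)"
  \<comment> \<open>The map \<open>\<Psi>\<close> factors \<open>T\<close> through the pair
    \<open>(SigYX f, SigSX f)\<close>, whose components range over relatively compact sets when
    \<open>f\<close> runs through the unit ball.\<close>
  define \<Psi> where "\<Psi> = (\<lambda>(u, v). Binv ((1 - lam) *\<^sub>R adjoint SigYX u - lam *\<^sub>R adjoint SigSX v))"
  have "bounded_linear T"
    unfolding T_def A Sig
    by (intro bounded_linear_compose[OF Binv(1)] bounded_linear_sub bounded_linear_const_scaleR
        bounded_linear_compose[OF PY.bounded_linear_adjoint_Sig PY.bounded_linear_Sig]
        bounded_linear_compose[OF PS.bounded_linear_adjoint_Sig PS.bounded_linear_Sig])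
  moreover have "b (T f) g = b f (T g)" for f g
    using bT b.sym by (metis A_inner inner_commute)
  moreover have "compact (\<Psi> ` (LY \<times> LS))"
  proof (intro compact_continuous_image compact_Times)
    show "compact LY" unfolding LY_def Sig by (rule PY.compact_Sig[OF assms(12)])
    show "compact LS" unfolding LS_def Sig by (rule PS.compact_Sig[OF assms(14)])
    show "continuous_on (LY \<times> LS) \<Psi>"
      unfolding \<Psi>_def case_prod_unfold Sig
      by (intro bounded_linear.continuous_on[OF Binv(1)] continuous_intros
          bounded_linear.continuous_on[OF PY.bounded_linear_adjoint_Sig]
          bounded_linear.continuous_on[OF PS.bounded_linear_adjoint_Sig])
  qed
  moreover have "T ` cball 0 1 \<subseteq> \<Psi> ` (LY \<times> LS)"
  proof (rule image_subsetI)
    fix f :: 'hx assume "f \<in> cball 0 1"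
    then have "(SigYX f, SigSX f) \<in> LY \<times> LS"
      unfolding LY_def LS_def by (intro SigmaI) (auto intro: subsetD[OF closure_subset])
    moreover have "T f = \<Psi> (SigYX f, SigSX f)" by (simp add: T_def A \<Psi>_def)
    ultimately show "T f \<in> \<Psi> ` (LY \<times> LS)" by blast
  qed
  ultimately interpret compact_selfadjoint b \<gamma> T "\<Psi> ` (LY \<times> LS)"
    using \<open>coercive_form b \<gamma>\<close>
    by (intro compact_selfadjoint.intro compact_selfadjoint_axioms.intro)
  have eig: "gen_eigenspace A B \<tau> = eigenspace \<tau>" for \<tau>
  proof -
    \<comment> \<open>Testing with \<open>g\<close> turns \<open>T f - \<tau> *\<^sub>R f\<close>
      under \<open>b\<close> into \<open>A f - \<tau> *\<^sub>R B f\<close> under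
      \<open>inner\<close>; both forms are nondegenerate.\<close>
    have "A f = \<tau> *\<^sub>R B f \<longleftrightarrow> T f = \<tau> *\<^sub>R f" for f
    proof
      assume "A f = \<tau> *\<^sub>R B f"
      then have "b (T f - \<tau> *\<^sub>R f) g = 0" for g
        by (simp add: b.diff_left b.scaleR_left bT) (simp add: b_def)
      then have "T f - \<tau> *\<^sub>R f = 0" using b.self_eq_0_iff by blast
      then show "T f = \<tau> *\<^sub>R f" by simp
    next
      assume "T f = \<tau> *\<^sub>R f"
      then have "A f \<bullet> g = (\<tau> *\<^sub>R B f) \<bullet> g" for g
        using bT[of f g] by (simp add: b.scaleR_left) (simp add: b_def)
      then show "A f = \<tau> *\<^sub>R B f" by (metis vector_eq_rdot)
    qed
    then show ?thesis by (simp add: gen_eigenspace_def eigenspace_def)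
  qed
  have largest: "largest_gen_eigenvalues A B r \<tau> \<longleftrightarrow> largest_eigenvalues {1..r} \<tau>" for \<tau>
    by (simp add: largest_gen_eigenvalues_def largest_eigenvalues_def gen_multiplicity_eq eig)
  have feas: "f \<in> feasible M evX X \<gamma> r \<longleftrightarrow> b.orthonormal {1..r} f" for f
    by (simp add: feasible_def b.orthonormal_def b_cov)
  have J_eq: "J f = (\<Sum>i\<in>{1..r}. b (T (f i)) (f i))" for f
    unfolding J bT A_inner PY.dep_eq[OF assms(12)] PS.dep_eq[OF assms(14)] Sig
    by (simp add: sum_subtractf sum_distrib_left)
  show ?thesis
  proof (intro conjI allI impI)
    fix \<tau> assume \<tau>: "largest_gen_eigenvalues A B r \<tau>"
    then show "\<exists>f\<in>feasible M evX X \<gamma> r. \<forall>i\<in>{1..r}. f i \<in> gen_eigenspace A B (\<tau> i)"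
      using eigenfamily_exists[of "{1..r}" \<tau>]
      unfolding largest largest_eigenvalues_def eig Bex_def feas by blast
    show "\<forall>f\<in>feasible M evX X \<gamma> r. (\<forall>i\<in>{1..r}. f i \<in> gen_eigenspace A B (\<tau> i)) \<longrightarrow>
        is_arg_max J (\<lambda>g. g \<in> feasible M evX X \<gamma> r) f"
      using largest_eigenfamily_maximizes_trace[of "{1..r}" \<tau>] \<tau>
      unfolding largest eig feas Ball_def is_arg_max_linorder J_eq by blast
  next
    assume "\<exists>g. is_arg_max J (\<lambda>g. g \<in> feasible M evX X \<gamma> r) g"
    then obtain g where "b.orthonormal {1..r} g"
      "\<And>f. b.orthonormal {1..r} f \<Longrightarrow> (\<Sum>i\<in>{1..r}. b (T (f i)) (f i)) \<le> (\<Sum>i\<in>{1..r}. b (T (g i)) (g i))"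
      unfolding is_arg_max_linorder feas J_eq by blast
    then show "\<exists>\<tau>. largest_gen_eigenvalues A B r \<tau>"
      unfolding largest by (intro trace_maximizer_largest_eigenvalues[of _ g]) auto
  qed
qed

end
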